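(* Let $n\ge0$, let $\mathcal C$ be an $n$-Frobenius category, let $k\ge1$, $M,N\in\mathcal C$, let $\Omega^kN$ be a $k$-th syzygy of $N$, and let $\gamma\in\operatorname{Ext}^k(M,\Omega^kN)$. Then: (1) there exist a unit conflation $\delta\in\mathcal U^k(\Omega^kN)$ and a morphism $f$ of $\mathcal C$ such that $\gamma=\delta f$; (2) there exist a unit conflation $\delta\in\mathcal U_k(M)$ and a morphism $g$ of $\mathcal C$ such that $\gamma=g\delta$.
   Context: Let $\mathcal A$ be an abelian category and $\mathcal C$ a full additive extension-closed subcategory with the inherited exact structure: conflations are short exact sequences of $\mathcal A$ with all terms in $\mathcal C$ (first map an inflation, second a deflation). A conflation of length $t\ge1$ is an exact sequence $B\to X_{t-1}\to\cdots\to X_0\to A$ spliced from $t$ conflations; $\operatorname{Ext}^t(A,B)=\operatorname{Ext}^t_{\mathcal C}(A,B)$ is the abelian group of their equivalence classes. $g\gamma$ and $\gamma h$ denote push-out along $g$ and pull-back along $h$. $P\in\mathcal C$ is $n$-projective (resp. $n$-injective) if $\operatorname{Ext}^i(P,Y)=0$ (resp. $\operatorname{Ext}^i(Y,P)=0$) for all $i>n$ and $Y\in\mathcal C$. $\mathcal C$ is $n$-Frobenius if every object has a deflation from an $n$-projective and an inflation into an $n$-injective, and the $n$-projectives coincide with the $n$-injectives. A unit conflation of length $k$ is a conflation $B\to P_{k-1}\to\cdots\to P_0\to A$ of length $k$ with all $P_i$ $n$-projective; then $B$ is called a $k$-th syzygy of $A$, denoted $\Omega^kA$. $\mathcal U_k(A)$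 (resp. $\mathcal U^k(B)$) is the class of unit conflations of length $k$ ending at $A$ (resp. beginning with $B$). Equalities are in $\operatorname{Ext}^k$. *)

theory Defs
  imports "HOL-Algebra.Group"
begin

section \<open>Abelian categories\<close>

record ('o, 'm) precat =
  Obj :: "'o set"
  Arr :: "'m set"
  Dom :: "'m \<Rightarrow> 'o"
  Cod :: "'m \<Rightarrow> 'o"
  Idm :: "'o \<Rightarrow> 'm"
  Comp :: "'m \<Rightarrow> 'm \<Rightarrow> 'm"  (infixl \<open>\<cdot>\<index>\<close> 70)  \<comment> \<open>\<open>g \<cdot> f\<close> is \<open>f\<close> followed by \<open>g\<close>\<close>
  Plus :: "'m \<Rightarrow> 'm \<Rightarrow> 'm"  (infixl \<open>\<boxplus>\<index>\<close> 65)
  Zero :: "'o \<Rightarrow> 'o \<Rightarrow> 'm"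

definition homset :: "('o, 'm) precat \<Rightarrow> 'o \<Rightarrow> 'o \<Rightarrow> 'm set" where
  "homset \<A> X Y = {f \<in> Arr \<A>. Dom \<A> f = X \<and> Cod \<A> f = Y}"

locale category =
  fixes \<A> :: "('o, 'm) precat" (structure)
  assumes Dom_in: "f \<in> Arr \<A> \<Longrightarrow> Dom \<A> f \<in> Obj \<A>"
    and Cod_in: "f \<in> Arr \<A> \<Longrightarrow> Cod \<A> f \<in> Obj \<A>"
    and Idm_in: "X \<in> Obj \<A> \<Longrightarrow> Idm \<A> X \<in> homset \<A> X X"
    and Comp_in: "\<lbrakk>f \<in> homset \<A> X Y; g \<in> homset \<A> Y Z\<rbrakk> \<Longrightarrow> g \<cdot> f \<in> homset \<A> X Z"
    and Comp_assoc: "\<lbrakk>f \<in> homset \<A> W X; g \<in> homset \<A> X Y; h \<in> homset \<A> Y Z\<rbrakk>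
      \<Longrightarrow> (h \<cdot> g) \<cdot> f = h \<cdot> (g \<cdot> f)"
    and Comp_Idm_left: "f \<in> homset \<A> X Y \<Longrightarrow> Idm \<A> Y \<cdot> f = f"
    and Comp_Idm_right: "f \<in> homset \<A> X Y \<Longrightarrow> f \<cdot> Idm \<A> X = f"

definition hom_group :: "('o, 'm) precat \<Rightarrow> 'o \<Rightarrow> 'o \<Rightarrow> 'm monoid" where
  "hom_group \<A> X Y =
    \<lparr>carrier = homset \<A> X Y, monoid.mult = Plus \<A>, one = Zero \<A> X Y\<rparr>"

locale preadditive_category = category +
  assumes hom_group: "\<lbrakk>X \<in> Obj \<A>; Y \<in> Obj \<A>\<rbrakk> \<Longrightarrow> comm_group (hom_group \<A> X Y)"
    and Comp_Plus_right: "\<lbrakk>f \<in> homset \<A> X Y; f' \<in> homset \<A> X Y; g \<in> homset \<A> Y Z\<rbrakk>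
      \<Longrightarrow> g \<cdot> (f \<boxplus> f') = g \<cdot> f \<boxplus> g \<cdot> f'"
    and Comp_Plus_left: "\<lbrakk>f \<in> homset \<A> X Y; g \<in> homset \<A> Y Z; g' \<in> homset \<A> Y Z\<rbrakk>
      \<Longrightarrow> (g \<boxplus> g') \<cdot> f = g \<cdot> f \<boxplus> g' \<cdot> f"

definition is_zero_object :: "('o, 'm) precat \<Rightarrow> 'o \<Rightarrow> bool" where
  "is_zero_object \<A> Z \<longleftrightarrow> Z \<in> Obj \<A> \<and>
    (\<forall>X \<in> Obj \<A>. (\<exists>!f. f \<in> homset \<A> Z X) \<and> (\<exists>!f. f \<in> homset \<A> X Z))"

definition is_biproduct ::
  "('o, 'm) precat \<Rightarrow> 'o \<Rightarrow> 'o \<Rightarrow> 'o \<Rightarrow> 'm \<Rightarrow> 'm \<Rightarrow> 'm \<Rightarrow> 'm \<Rightarrow> bool" where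
  "is_biproduct \<A> X Y S i j p q \<longleftrightarrow>
    i \<in> homset \<A> X S \<and> j \<in> homset \<A> Y S \<and> p \<in> homset \<A> S X \<and> q \<in> homset \<A> S Y \<and>
    p \<cdot>\<^bsub>\<A>\<^esub> i = Idm \<A> X \<and> q \<cdot>\<^bsub>\<A>\<^esub> j = Idm \<A> Y \<and>
    q \<cdot>\<^bsub>\<A>\<^esub> i = Zero \<A> X Y \<and> p \<cdot>\<^bsub>\<A>\<^esub> j = Zero \<A> Y X \<and>
    i \<cdot>\<^bsub>\<A>\<^esub> p \<boxplus>\<^bsub>\<A>\<^esub> j \<cdot>\<^bsub>\<A>\<^esub> q = Idm \<A> S"

definition is_kernel :: "('o, 'm) precat \<Rightarrow> 'm \<Rightarrow> 'm \<Rightarrow> bool" where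
  "is_kernel \<A> f k \<longleftrightarrow>
    f \<in> Arr \<A> \<and> k \<in> Arr \<A> \<and> Cod \<A> k = Dom \<A> f \<and>
    f \<cdot>\<^bsub>\<A>\<^esub> k = Zero \<A> (Dom \<A> k) (Cod \<A> f) \<and>
    (\<forall>h \<in> Arr \<A>. Cod \<A> h = Dom \<A> f \<and> f \<cdot>\<^bsub>\<A>\<^esub> h = Zero \<A> (Dom \<A> h) (Cod \<A> f) \<longrightarrow>
      (\<exists>!u. u \<in> homset \<A> (Dom \<A> h) (Dom \<A> k) \<and> k \<cdot>\<^bsub>\<A>\<^esub> u = h))"

definition is_cokernel :: "('o, 'm) precat \<Rightarrow> 'm \<Rightarrow> 'm \<Rightarrow> bool" where
  "is_cokernel \<A> f c \<longleftrightarrow>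
    f \<in> Arr \<A> \<and> c \<in> Arr \<A> \<and> Dom \<A> c = Cod \<A> f \<and>
    c \<cdot>\<^bsub>\<A>\<^esub> f = Zero \<A> (Dom \<A> f) (Cod \<A> c) \<and>
    (\<forall>h \<in> Arr \<A>. Dom \<A> h = Cod \<A> f \<and> h \<cdot>\<^bsub>\<A>\<^esub> f = Zero \<A> (Dom \<A> f) (Cod \<A> h) \<longrightarrow>
      (\<exists>!u. u \<in> homset \<A> (Cod \<A> c) (Cod \<A> h) \<and> u \<cdot>\<^bsub>\<A>\<^esub> c = h))"

definition is_mono :: "('o, 'm) precat \<Rightarrow> 'm \<Rightarrow> bool" where
  "is_mono \<A> f \<longleftrightarrow> f \<in> Arr \<A> \<and>
    (\<forall>W. \<forall>u \<in> homset \<A> W (Dom \<A> f). \<forall>v \<in> homset \<A> W (Dom \<A> f).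
      f \<cdot>\<^bsub>\<A>\<^esub> u = f \<cdot>\<^bsub>\<A>\<^esub> v \<longrightarrow> u = v)"

definition is_epi :: "('o, 'm) precat \<Rightarrow> 'm \<Rightarrow> bool" where
  "is_epi \<A> f \<longleftrightarrow> f \<in> Arr \<A> \<and>
    (\<forall>W. \<forall>u \<in> homset \<A> (Cod \<A> f) W. \<forall>v \<in> homset \<A> (Cod \<A> f) W.
      u \<cdot>\<^bsub>\<A>\<^esub> f = v \<cdot>\<^bsub>\<A>\<^esub> f \<longrightarrow> u = v)"

locale abelian_category = preadditive_category +
  assumes ex_zero_object: "\<exists>Z. is_zero_object \<A> Z"
    and ex_biproduct: "\<lbrakk>X \<in> Obj \<A>; Y \<in> Obj \<A>\<rbrakk> \<Longrightarrow> \<exists>S i j p q. is_biproduct \<A> X Y S i j p q"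
    and ex_kernel: "f \<in> Arr \<A> \<Longrightarrow> \<exists>k. is_kernel \<A> f k"
    and ex_cokernel: "f \<in> Arr \<A> \<Longrightarrow> \<exists>c. is_cokernel \<A> f c"
    and mono_is_kernel: "is_mono \<A> m \<Longrightarrow> \<exists>f. is_kernel \<A> f m"
    and epi_is_cokernel: "is_epi \<A> e \<Longrightarrow> \<exists>f. is_cokernel \<A> f e"

definition short_exact :: "('o, 'm) precat \<Rightarrow> 'm \<Rightarrow> 'm \<Rightarrow> bool" where
  "short_exact \<A> i p \<longleftrightarrow> is_kernel \<A> p i \<and> is_cokernel \<A> i p"

text \<open>\<open>is_pushout \<A> b g u b'\<close>: the square \<open>u \<cdot> b = b' \<cdot> g\<close> is a push-out of the span \<open>b, g\<close>.\<close>

definition is_pushout :: "('o, 'm) precat \<Rightarrow> 'm \<Rightarrow> 'm \<Rightarrow> 'm \<Rightarrow> 'm \<Rightarrow> bool" where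
  "is_pushout \<A> b g u b' \<longleftrightarrow>
    b \<in> Arr \<A> \<and> g \<in> Arr \<A> \<and> u \<in> Arr \<A> \<and> b' \<in> Arr \<A> \<and>
    Dom \<A> b = Dom \<A> g \<and> Dom \<A> u = Cod \<A> b \<and> Dom \<A> b' = Cod \<A> g \<and> Cod \<A> u = Cod \<A> b' \<and>
    u \<cdot>\<^bsub>\<A>\<^esub> b = b' \<cdot>\<^bsub>\<A>\<^esub> g \<and>
    (\<forall>W. \<forall>x \<in> homset \<A> (Cod \<A> b) W. \<forall>y \<in> homset \<A> (Cod \<A> g) W.
      x \<cdot>\<^bsub>\<A>\<^esub> b = y \<cdot>\<^bsub>\<A>\<^esub> g \<longrightarrow>
      (\<exists>!w. w \<in> homset \<A> (Cod \<A> u) W \<and> w \<cdot>\<^bsub>\<A>\<^esub> u = x \<and> w \<cdot>\<^bsub>\<A>\<^esub> b' = y))"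

text \<open>\<open>is_pullback \<A> a h v a'\<close>: the square \<open>a \<cdot> v = h \<cdot> a'\<close> is a pull-back of the cospan \<open>a, h\<close>.\<close>

definition is_pullback :: "('o, 'm) precat \<Rightarrow> 'm \<Rightarrow> 'm \<Rightarrow> 'm \<Rightarrow> 'm \<Rightarrow> bool" where
  "is_pullback \<A> a h v a' \<longleftrightarrow>
    a \<in> Arr \<A> \<and> h \<in> Arr \<A> \<and> v \<in> Arr \<A> \<and> a' \<in> Arr \<A> \<and>
    Cod \<A> a = Cod \<A> h \<and> Cod \<A> v = Dom \<A> a \<and> Cod \<A> a' = Dom \<A> h \<and> Dom \<A> v = Dom \<A> a' \<and>
    a \<cdot>\<^bsub>\<A>\<^esub> v = h \<cdot>\<^bsub>\<A>\<^esub> a' \<and>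
    (\<forall>W. \<forall>x \<in> homset \<A> W (Dom \<A> a). \<forall>y \<in> homset \<A> W (Dom \<A> h).
      a \<cdot>\<^bsub>\<A>\<^esub> x = h \<cdot>\<^bsub>\<A>\<^esub> y \<longrightarrow>
      (\<exists>!w. w \<in> homset \<A> W (Dom \<A> v) \<and> v \<cdot>\<^bsub>\<A>\<^esub> w = x \<and> a' \<cdot>\<^bsub>\<A>\<^esub> w = y))"


section \<open>Extension-closed subcategories and conflations\<close>

text \<open>A full subcategory is given by its set \<open>\<C>\<close> of objects.\<close>

locale extension_closed_subcategory = abelian_category +
  fixes \<C> :: "'o set"
  assumes subset_Obj: "\<C> \<subseteq> Obj \<A>"
    and zero_object_in: "\<exists>Z \<in> \<C>. is_zero_object \<A> Z"
    and biproduct_in: "\<lbrakk>X \<in> \<C>; Y \<in> \<C>\<rbrakk> \<Longrightarrow> \<exists>S \<in> \<C>. \<exists>i j p q. is_biproduct \<A> X Y S i j p q"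
    and extension_in: "\<lbrakk>short_exact \<A> i p; Dom \<A> i \<in> \<C>; Cod \<A> p \<in> \<C>\<rbrakk> \<Longrightarrow> Dom \<A> p \<in> \<C>"

definition conflation :: "('o, 'm) precat \<Rightarrow> 'o set \<Rightarrow> 'm \<Rightarrow> 'm \<Rightarrow> bool" where
  "conflation \<A> \<C> i p \<longleftrightarrow>
    short_exact \<A> i p \<and> Dom \<A> i \<in> \<C> \<and> Dom \<A> p \<in> \<C> \<and> Cod \<A> p \<in> \<C>"

definition inflation :: "('o, 'm) precat \<Rightarrow> 'o set \<Rightarrow> 'm \<Rightarrow> bool" where
  "inflation \<A> \<C> i \<longleftrightarrow> (\<exists>p. conflation \<A> \<C> i p)"

definition deflation :: "('o, 'm) precat \<Rightarrow> 'o set \<Rightarrow> 'm \<Rightarrow> bool" where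
  "deflation \<A> \<C> p \<longleftrightarrow> (\<exists>i. conflation \<A> \<C> i p)"

text \<open>
  A sequence \<open>B \<rightarrow> X\<^sub>t\<^sub>-\<^sub>1 \<rightarrow> \<dots> \<rightarrow> X\<^sub>0 \<rightarrow> A\<close> is represented by the list \<open>E\<close> of its \<open>t + 1\<close> maps, numbered
  from the right: \<open>E ! 0 : X\<^sub>0 \<rightarrow> A\<close>, \<open>E ! j : X\<^sub>j \<rightarrow> X\<^sub>j\<^sub>-\<^sub>1\<close> for \<open>0 < j < t\<close>, and \<open>E ! t : B \<rightarrow> X\<^sub>t\<^sub>-\<^sub>1\<close>.
  Hence \<open>X\<^sub>j = Dom \<A> (E ! j)\<close> for \<open>j < t\<close>. The splicing conflations are
  \<open>K (j + 1) \<rightarrow> X\<^sub>j \<rightarrow> K j\<close> for \<open>j < t\<close>, with maps \<open>i j\<close> and \<open>p j\<close>.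
\<close>

definition long_conflations ::
  "('o, 'm) precat \<Rightarrow> 'o set \<Rightarrow> nat \<Rightarrow> 'o \<Rightarrow> 'o \<Rightarrow> 'm list set" where
  "long_conflations \<A> \<C> t A B =
    {E. 1 \<le> t \<and> length E = t + 1 \<and>
      (\<exists>K i p. K 0 = A \<and> K t = B \<and>
        (\<forall>j<t. conflation \<A> \<C> (i j) (p j) \<and> Dom \<A> (i j) = K (j + 1) \<and> Cod \<A> (p j) = K j) \<and>
        E ! 0 = p 0 \<and> E ! t = i (t - 1) \<and>
        (\<forall>j. 0 < j \<and> j < t \<longrightarrow> E ! j = i (j - 1) \<cdot>\<^bsub>\<A>\<^esub> p j))}"


section \<open>Yoneda Ext\<close>

text \<open>Existence of a morphism of sequences that is the identity at both ends.\<close>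

definition yoneda_step :: "('o, 'm) precat \<Rightarrow> nat \<Rightarrow> 'm list \<Rightarrow> 'm list \<Rightarrow> bool" where
  "yoneda_step \<A> t E E' \<longleftrightarrow>
    (\<exists>\<phi>. (\<forall>j<t. \<phi> j \<in> homset \<A> (Dom \<A> (E ! j)) (Dom \<A> (E' ! j))) \<and>
      E' ! 0 \<cdot>\<^bsub>\<A>\<^esub> \<phi> 0 = E ! 0 \<and> \<phi> (t - 1) \<cdot>\<^bsub>\<A>\<^esub> (E ! t) = E' ! t \<and>
      (\<forall>j. 0 < j \<and> j < t \<longrightarrow> E' ! j \<cdot>\<^bsub>\<A>\<^esub> \<phi> j = \<phi> (j - 1) \<cdot>\<^bsub>\<A>\<^esub> (E ! j)))"

definition ext_rel ::
  "('o, 'm) precat \<Rightarrow> 'o set \<Rightarrow> nat \<Rightarrow> 'o \<Rightarrow> 'o \<Rightarrow> ('m list \<times> 'm list) set" where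
  "ext_rel \<A> \<C> t A B =
    {(E, E'). E \<in> long_conflations \<A> \<C> t A B \<and> E' \<in> long_conflations \<A> \<C> t A B \<and>
      equivclp (\<lambda>F F'. F \<in> long_conflations \<A> \<C> t A B \<and> F' \<in> long_conflations \<A> \<C> t A B \<and>
        yoneda_step \<A> t F F') E E'}"

definition Ext ::
  "('o, 'm) precat \<Rightarrow> 'o set \<Rightarrow> nat \<Rightarrow> 'o \<Rightarrow> 'o \<Rightarrow> 'm list set set" where
  "Ext \<A> \<C> t A B = long_conflations \<A> \<C> t A B // ext_rel \<A> \<C> t A B"

definition ext_class ::
  "('o, 'm) precat \<Rightarrow> 'o set \<Rightarrow> nat \<Rightarrow> 'o \<Rightarrow> 'o \<Rightarrow> 'm list \<Rightarrow> 'm list set" where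
  "ext_class \<A> \<C> t A B E = ext_rel \<A> \<C> t A B `` {E}"

text \<open>
  The neutral element of the Baer sum is represented by the split conflation
  \<open>B \<rightarrow> A \<oplus> B \<rightarrow> A\<close> if \<open>t = 1\<close>, and by \<open>B = B \<rightarrow> 0 \<rightarrow> \<dots> \<rightarrow> 0 \<rightarrow> A = A\<close> if \<open>t \<ge> 2\<close>.
\<close>

definition trivial_sequence ::
  "('o, 'm) precat \<Rightarrow> 'o set \<Rightarrow> nat \<Rightarrow> 'o \<Rightarrow> 'o \<Rightarrow> 'm list \<Rightarrow> bool" where
  "trivial_sequence \<A> \<C> t A B E \<longleftrightarrow>
    (if t = 1 then \<exists>S \<in> \<C>. \<exists>i j p q. is_biproduct \<A> A B S i j p q \<and> E = [p, j]
     else \<exists>Z \<in> \<C>. is_zero_object \<A> Z \<and>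
       (let X = (\<lambda>j. if j = 0 then A else if j = t - 1 then B else Z)
        in E = Idm \<A> A # map (\<lambda>j. Zero \<A> (X j) (X (j - 1))) [1..<t] @ [Idm \<A> B]))"

definition ext_zero ::
  "('o, 'm) precat \<Rightarrow> 'o set \<Rightarrow> nat \<Rightarrow> 'o \<Rightarrow> 'o \<Rightarrow> 'm list set" where
  "ext_zero \<A> \<C> t A B = ext_rel \<A> \<C> t A B `` {E. trivial_sequence \<A> \<C> t A B E}"

text \<open>
  Push-out along \<open>g : B \<rightarrow> B'\<close> replaces \<open>X\<^sub>t\<^sub>-\<^sub>1\<close> by the push-out \<open>X'\<close> of \<open>X\<^sub>t\<^sub>-\<^sub>1 \<leftarrow> B \<rightarrow> B'\<close>; the map
  leaving \<open>X'\<close> is induced by the old one and by zero on \<open>B'\<close>. Dually for the pull-back along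
  \<open>h : A' \<rightarrow> A\<close>, which changes only \<open>X\<^sub>0\<close>.
\<close>

definition pushout_sequence :: "('o, 'm) precat \<Rightarrow> nat \<Rightarrow> 'm \<Rightarrow> 'm list \<Rightarrow> 'm list \<Rightarrow> bool" where
  "pushout_sequence \<A> t g E E' \<longleftrightarrow>
    length E' = t + 1 \<and> (\<forall>j < t - 1. E' ! j = E ! j) \<and>
    (\<exists>u. is_pushout \<A> (E ! t) g u (E' ! t) \<and>
      E' ! (t - 1) \<in> homset \<A> (Cod \<A> u) (Cod \<A> (E ! (t - 1))) \<and>
      E' ! (t - 1) \<cdot>\<^bsub>\<A>\<^esub> u = E ! (t - 1) \<and>
      E' ! (t - 1) \<cdot>\<^bsub>\<A>\<^esub> (E' ! t) = Zero \<A> (Cod \<A> g) (Cod \<A> (E ! (t - 1))))"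

definition pullback_sequence :: "('o, 'm) precat \<Rightarrow> nat \<Rightarrow> 'm \<Rightarrow> 'm list \<Rightarrow> 'm list \<Rightarrow> bool" where
  "pullback_sequence \<A> t h E E' \<longleftrightarrow>
    length E' = t + 1 \<and> (\<forall>j. 1 < j \<and> j \<le> t \<longrightarrow> E' ! j = E ! j) \<and>
    (\<exists>v. is_pullback \<A> (E ! 0) h v (E' ! 0) \<and>
      E' ! 1 \<in> homset \<A> (Dom \<A> (E ! 1)) (Dom \<A> v) \<and>
      v \<cdot>\<^bsub>\<A>\<^esub> (E' ! 1) = E ! 1 \<and>
      E' ! 0 \<cdot>\<^bsub>\<A>\<^esub> (E' ! 1) = Zero \<A> (Dom \<A> (E ! 1)) (Dom \<A> h))"

text \<open>
  \<open>ext_push \<A> \<C> t A g c\<close> is \<open>g c \<in> Ext\<^sup>t(A, B')\<close> for \<open>c \<in> Ext\<^sup>t(A, B)\<close> and \<open>g : B \<rightarrow> B'\<close>;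
  \<open>ext_pull \<A> \<C> t B h c\<close> is \<open>c h \<in> Ext\<^sup>t(A', B)\<close> for \<open>c \<in> Ext\<^sup>t(A, B)\<close> and \<open>h : A' \<rightarrow> A\<close>.
\<close>

definition ext_push ::
  "('o, 'm) precat \<Rightarrow> 'o set \<Rightarrow> nat \<Rightarrow> 'o \<Rightarrow> 'm \<Rightarrow> 'm list set \<Rightarrow> 'm list set" where
  "ext_push \<A> \<C> t A g c =
    ext_rel \<A> \<C> t A (Cod \<A> g) `` {E'. \<exists>E \<in> c. pushout_sequence \<A> t g E E'}"

definition ext_pull ::
  "('o, 'm) precat \<Rightarrow> 'o set \<Rightarrow> nat \<Rightarrow> 'o \<Rightarrow> 'm \<Rightarrow> 'm list set \<Rightarrow> 'm list set" where
  "ext_pull \<A> \<C> t B h c =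
    ext_rel \<A> \<C> t (Dom \<A> h) B `` {E'. \<exists>E \<in> c. pullback_sequence \<A> t h E E'}"


section \<open>\<open>n\<close>-Frobenius categories, unit conflations and syzygies\<close>

definition n_projective :: "('o, 'm) precat \<Rightarrow> 'o set \<Rightarrow> nat \<Rightarrow> 'o \<Rightarrow> bool" where
  "n_projective \<A> \<C> n P \<longleftrightarrow> P \<in> \<C> \<and>
    (\<forall>i>n. \<forall>Y \<in> \<C>. Ext \<A> \<C> i P Y = {ext_zero \<A> \<C> i P Y})"

definition n_injective :: "('o, 'm) precat \<Rightarrow> 'o set \<Rightarrow> nat \<Rightarrow> 'o \<Rightarrow> bool" where
  "n_injective \<A> \<C> n Q \<longleftrightarrow> Q \<in> \<C> \<and>
    (\<forall>i>n. \<forall>Y \<in> \<C>. Ext \<A> \<C> i Y Q = {ext_zero \<A> \<C> i Y Q})"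

locale n_Frobenius_category = extension_closed_subcategory +
  fixes n :: nat
  assumes enough_projectives:
      "X \<in> \<C> \<Longrightarrow> \<exists>P p. n_projective \<A> \<C> n P \<and> p \<in> homset \<A> P X \<and> deflation \<A> \<C> p"
    and enough_injectives:
      "X \<in> \<C> \<Longrightarrow> \<exists>Q i. n_injective \<A> \<C> n Q \<and> i \<in> homset \<A> X Q \<and> inflation \<A> \<C> i"
    and projective_iff_injective: "n_projective \<A> \<C> n X \<longleftrightarrow> n_injective \<A> \<C> n X"

definition unit_conflations ::
  "('o, 'm) precat \<Rightarrow> 'o set \<Rightarrow> nat \<Rightarrow> nat \<Rightarrow> 'o \<Rightarrow> 'o \<Rightarrow> 'm list set" where
  "unit_conflations \<A> \<C> n k A B =
    {E \<in> long_conflations \<A> \<C> k A B. \<forall>j<k. n_projective \<A> \<C> n (Dom \<A> (E ! j))}"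

definition is_syzygy ::
  "('o, 'm) precat \<Rightarrow> 'o set \<Rightarrow> nat \<Rightarrow> nat \<Rightarrow> 'o \<Rightarrow> 'o \<Rightarrow> bool" where
  "is_syzygy \<A> \<C> n k A B \<longleftrightarrow> unit_conflations \<A> \<C> n k A B \<noteq> {}"

text \<open>\<open>\<U>\<^sub>k(A)\<close> and \<open>\<U>\<^sup>k(B)\<close>.\<close>

definition units_ending_at ::
  "('o, 'm) precat \<Rightarrow> 'o set \<Rightarrow> nat \<Rightarrow> nat \<Rightarrow> 'o \<Rightarrow> 'm list set" where
  "units_ending_at \<A> \<C> n k A = (\<Union>B \<in> \<C>. unit_conflations \<A> \<C> n k A B)"

definition units_beginning_with ::
  "('o, 'm) precat \<Rightarrow> 'o set \<Rightarrow> nat \<Rightarrow> nat \<Rightarrow> 'o \<Rightarrow> 'm list set" where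
  "units_beginning_with \<A> \<C> n k B = (\<Union>A \<in> \<C>. unit_conflations \<A> \<C> n k A B)"

end

theory Submission
  imports Defs
begin

text \<open>
  For part (2), let \<open>E\<close> represent \<open>\<gamma>\<close>, spliced from conflations \<open>K\<^bsub>j+1\<^esub> \<rightarrow> X\<^sub>j \<rightarrow> K\<^sub>j\<close> with \<open>K\<^sub>0 = M\<close>.
  Given \<open>K'\<^sub>j \<rightarrow> K\<^sub>j\<close> (the identity for \<open>j = 0\<close>), pull \<open>X\<^sub>j \<rightarrow> K\<^sub>j\<close> back along it and cover the result by
  an \<open>n\<close>-projective \<open>P\<^sub>j\<close>. The composite \<open>P\<^sub>j \<rightarrow> K'\<^sub>j\<close> is a deflation, and its kernel \<open>K'\<^bsub>j+1\<^esub>\<close> maps to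
  \<open>K\<^bsub>j+1\<^esub>\<close>. Splicing gives a unit conflation \<open>\<delta>\<close> with a morphism to \<open>E\<close> that is the identity on \<open>M\<close>
  and some \<open>g\<close> on the left, so \<open>E\<close> is equivalent to the push-out of \<open>\<delta>\<close> along \<open>g\<close>. Part (1) is
  part (2) in the opposite category, since the \<open>n\<close>-injectives are the \<open>n\<close>-projectives.
\<close>

section \<open>Pull-backs and pull-back of conflations\<close>

text \<open>For \<open>n\<close> at least 1 an \<open>n\<close>-projective need not lift along
  deflations, so a resolution of \<open>M\<close> fixed in advance has no evident morphism to
  \<open>E\<close>; hence the resolution is grown over \<open>E\<close>. Turning a morphism over
  \<open>g\<close> into an equality in Ext meets a second obstacle: sequences are identified by
  zigzags of morphisms that fix both ends, and \<open>ext_push\<close> gathers every push-out of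
  every representative. The universal property of the push-out settles both points. It converts a
  morphism over \<open>g\<close> into one that fixes both ends, and it carries each link of a zigzag
  to a link between push-outs. The constructions stay inside \<open>\<C>\<close> because a pull-back
  leaves the kernel unchanged, so the new middle term is an extension of objects of
  \<open>\<C>\<close>. Push-outs are not built separately: they are pull-backs in
  \<open>op_cat\<close>. The covering objects form an arbitrary class, so the result can be dualized
  with that class kept fixed.\<close>

context category
begin

text \<open>Typing through equations for \<open>Dom\<close> and \<open>Cod\<close> instead of
  \<open>homset\<close> membership lets the simplifier check composability by itself; most later
  facts are stated in this form.\<close>

lemma comp_simps [simp]:
  assumes "f \<in> Arr \<A>" "g \<in> Arr \<A>" "Cod \<A> f = Dom \<A> g"
  shows "g \<cdot> f \<in> Arr \<A>" "Dom \<A> (g \<cdot> f) = Dom \<A> f" "Cod \<A> (g \<cdot> f) = Cod \<A> g"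
  using Comp_in[of f "Dom \<A> f" "Dom \<A> g" g "Cod \<A> g"] assms by (auto simp: homset_def)

lemma comp_assoc [simp]:
  assumes "f \<in> Arr \<A>" "g \<in> Arr \<A>" "h \<in> Arr \<A>" "Cod \<A> f = Dom \<A> g" "Cod \<A> g = Dom \<A> h"
  shows "(h \<cdot> g) \<cdot> f = h \<cdot> (g \<cdot> f)"
  using Comp_assoc[of f "Dom \<A> f" "Dom \<A> g" g "Dom \<A> h" h "Cod \<A> h"] assms
  by (auto simp: homset_def)

text \<open>Since \<open>comp_assoc\<close> brackets composites to the right, a known product
  \<open>h \<cdot> g\<close> gets hidden once a further map is composed on the right. This rule
  applies the equation under such a composite.\<close>

lemma comp_reassoc:
  assumes "h \<cdot> g = k" "f \<in> Arr \<A>" "g \<in> Arr \<A>" "h \<in> Arr \<A>"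
    "Cod \<A> f = Dom \<A> g" "Cod \<A> g = Dom \<A> h"
  shows "h \<cdot> (g \<cdot> f) = k \<cdot> f"
  using assms comp_assoc by metis

lemma Idm_simps [simp]:
  assumes "X \<in> Obj \<A>"
  shows "Idm \<A> X \<in> Arr \<A>" "Dom \<A> (Idm \<A> X) = X" "Cod \<A> (Idm \<A> X) = X"
  using Idm_in[OF assms] by (auto simp: homset_def)

lemma comp_Idm [simp]:
  assumes "f \<in> Arr \<A>"
  shows "Cod \<A> f = X \<Longrightarrow> Idm \<A> X \<cdot> f = f" "Dom \<A> f = X \<Longrightarrow> f \<cdot> Idm \<A> X = f"
  using Comp_Idm_left[of f] Comp_Idm_right[of f] assms by (auto simp: homset_def)

lemma ex1_homsetI:
  assumes "u \<in> Arr \<A>" "Dom \<A> u = X" "Cod \<A> u = Y" "k \<cdot> u = h"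
    and "\<And>y. \<lbrakk>y \<in> Arr \<A>; Dom \<A> y = X; Cod \<A> y = Y; k \<cdot> y = h\<rbrakk> \<Longrightarrow> y = u"
  shows "\<exists>!u. u \<in> homset \<A> X Y \<and> k \<cdot> u = h"
  unfolding homset_def using assms by blast

lemma is_epiD:
  assumes "is_epi \<A> e" "u \<in> Arr \<A>" "v \<in> Arr \<A>" "Dom \<A> u = Cod \<A> e" "Dom \<A> v = Cod \<A> e"
    "Cod \<A> u = Cod \<A> v" "u \<cdot> e = v \<cdot> e"
  shows "u = v"
  using assms by (auto simp: is_epi_def homset_def)

lemma is_epi_comp:
  assumes "is_epi \<A> e" "is_epi \<A> f" "Cod \<A> e = Dom \<A> f"
  shows "is_epi \<A> (f \<cdot> e)"
proof -
  have Arr: "e \<in> Arr \<A>" "f \<in> Arr \<A>" using assms by (auto simp: is_epi_def)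
  show ?thesis
    unfolding is_epi_def homset_def
  proof (intro conjI allI ballI impI)
    show "f \<cdot> e \<in> Arr \<A>" using Arr assms by simp
    fix W u v
    assume u: "u \<in> {h \<in> Arr \<A>. Dom \<A> h = Cod \<A> (f \<cdot> e) \<and> Cod \<A> h = W}"
      and v: "v \<in> {h \<in> Arr \<A>. Dom \<A> h = Cod \<A> (f \<cdot> e) \<and> Cod \<A> h = W}"
      and eq: "u \<cdot> (f \<cdot> e) = v \<cdot> (f \<cdot> e)"
    have "(u \<cdot> f) \<cdot> e = (v \<cdot> f) \<cdot> e" using Arr assms u v eq by simp
    then have "u \<cdot> f = v \<cdot> f"
      by - (rule is_epiD[OF assms(1)]; (use Arr assms u v in auto))
    then show "u = v"
      by - (rule is_epiD[OF assms(2)]; (use Arr assms u v in auto))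
  qed
qed

lemma is_epi_cancel:
  assumes "is_epi \<A> (f \<cdot> e)" "e \<in> Arr \<A>" "f \<in> Arr \<A>" "Cod \<A> e = Dom \<A> f"
  shows "is_epi \<A> f"
  unfolding is_epi_def homset_def
proof (intro conjI allI ballI impI)
  fix W u v
  assume u: "u \<in> {h \<in> Arr \<A>. Dom \<A> h = Cod \<A> f \<and> Cod \<A> h = W}"
    and v: "v \<in> {h \<in> Arr \<A>. Dom \<A> h = Cod \<A> f \<and> Cod \<A> h = W}"
    and eq: "u \<cdot> f = v \<cdot> f"
  have "u \<cdot> (f \<cdot> e) = v \<cdot> (f \<cdot> e)"
    using comp_reassoc[OF eq, of e] u v assms(2-4) by simp
  then show "u = v"
    by - (rule is_epiD[OF assms(1)]; (use assms u v in auto))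
qed (use assms in simp)

lemma is_kernelE:
  assumes "is_kernel \<A> f k" "h \<in> Arr \<A>" "Cod \<A> h = Dom \<A> f" "f \<cdot> h = Zero \<A> (Dom \<A> h) (Cod \<A> f)"
  obtains u where "u \<in> Arr \<A>" "Dom \<A> u = Dom \<A> h" "Cod \<A> u = Dom \<A> k" "k \<cdot> u = h"
proof -
  have "\<exists>!u. u \<in> homset \<A> (Dom \<A> h) (Dom \<A> k) \<and> k \<cdot> u = h"
    using assms by (simp add: is_kernel_def)
  then show ?thesis using that by (auto simp: homset_def)
qed

lemma is_cokernelE:
  assumes "is_cokernel \<A> f c" "h \<in> Arr \<A>" "Dom \<A> h = Cod \<A> f" "h \<cdot> f = Zero \<A> (Dom \<A> f) (Cod \<A> h)"
  obtains u where "u \<in> Arr \<A>" "Dom \<A> u = Cod \<A> c" "Cod \<A> u = Cod \<A> h" "u \<cdot> c = h"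
proof -
  have "\<exists>!u. u \<in> homset \<A> (Cod \<A> c) (Cod \<A> h) \<and> u \<cdot> c = h"
    using assms by (simp add: is_cokernel_def)
  then show ?thesis using that by (auto simp: homset_def)
qed

lemma is_pullback_ex1:
  assumes "is_pullback \<A> a h v a'" "x \<in> homset \<A> W (Dom \<A> a)" "y \<in> homset \<A> W (Dom \<A> h)" "a \<cdot> x = h \<cdot> y"
  shows "\<exists>!w. w \<in> homset \<A> W (Dom \<A> v) \<and> v \<cdot> w = x \<and> a' \<cdot> w = y"
  using assms unfolding is_pullback_def by metis

lemma is_pullbackE:
  assumes "is_pullback \<A> a h v a'" "x \<in> Arr \<A>" "y \<in> Arr \<A>" "Cod \<A> x = Dom \<A> a" "Cod \<A> y = Dom \<A> h"
    "Dom \<A> x = Dom \<A> y" "a \<cdot> x = h \<cdot> y"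
  obtains w where "w \<in> Arr \<A>" "Dom \<A> w = Dom \<A> x" "Cod \<A> w = Dom \<A> v" "v \<cdot> w = x" "a' \<cdot> w = y"
proof -
  have "\<exists>!w. w \<in> homset \<A> (Dom \<A> x) (Dom \<A> v) \<and> v \<cdot> w = x \<and> a' \<cdot> w = y"
    using assms by (intro is_pullback_ex1[OF assms(1)]) (auto simp: homset_def)
  then show ?thesis using that by (auto simp: homset_def)
qed

lemma is_pullback_unique:
  assumes "is_pullback \<A> a h v a'" "w \<in> Arr \<A>" "w' \<in> Arr \<A>" "Cod \<A> w = Dom \<A> v" "Cod \<A> w' = Dom \<A> v"
    "Dom \<A> w = Dom \<A> w'" "v \<cdot> w = v \<cdot> w'" "a' \<cdot> w = a' \<cdot> w'"
  shows "w = w'"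
proof -
  have P: "a \<in> Arr \<A>" "h \<in> Arr \<A>" "v \<in> Arr \<A>" "a' \<in> Arr \<A>" "Cod \<A> a = Cod \<A> h"
    "Cod \<A> v = Dom \<A> a" "Cod \<A> a' = Dom \<A> h" "Dom \<A> v = Dom \<A> a'" "a \<cdot> v = h \<cdot> a'"
    using assms(1) by (auto simp: is_pullback_def)
  \<comment> \<open>The universal property speaks only about compatible pairs; compatibility of this
    pair is inherited from the commuting square.\<close>
  have "a \<cdot> (v \<cdot> w) = h \<cdot> (a' \<cdot> w)"
    using comp_reassoc[OF P(9), of w] P assms by simp
  then have "\<exists>!x. x \<in> homset \<A> (Dom \<A> w) (Dom \<A> v) \<and> v \<cdot> x = v \<cdot> w \<and> a' \<cdot> x = a' \<cdot> w"
    using P assms(2-6) by (intro is_pullback_ex1[OF assms(1)]) (auto simp: homset_def)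
  moreover have "w \<in> homset \<A> (Dom \<A> w) (Dom \<A> v)" "w' \<in> homset \<A> (Dom \<A> w) (Dom \<A> v)"
    using assms by (auto simp: homset_def)
  ultimately show ?thesis using assms by metis
qed

text \<open>The hypothesis \<open>zero\<close> bridges a gap: in a bare category nothing says that a
  composite with a zero map is zero. \<open>is_kernel_cancel\<close> removes it once the hom sets
  are groups.\<close>

lemma is_kernel_unique:
  assumes "is_kernel \<A> f k" "u \<in> Arr \<A>" "v \<in> Arr \<A>" "Cod \<A> u = Dom \<A> k" "Cod \<A> v = Dom \<A> k"
    "Dom \<A> u = Dom \<A> v" "k \<cdot> u = k \<cdot> v" and zero: "f \<cdot> (k \<cdot> u) = Zero \<A> (Dom \<A> u) (Cod \<A> f)"
  shows "u = v"
proof -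
  have "\<exists>!x. x \<in> homset \<A> (Dom \<A> u) (Dom \<A> k) \<and> k \<cdot> x = k \<cdot> u"
    using assms(1)[unfolded is_kernel_def, THEN conjunct2, THEN conjunct2, THEN conjunct2,
        THEN conjunct2, rule_format, of "k \<cdot> u"] assms(1-4) zero
    by (simp add: is_kernel_def)
  moreover have "u \<in> homset \<A> (Dom \<A> u) (Dom \<A> k)" "v \<in> homset \<A> (Dom \<A> u) (Dom \<A> k)"
    using assms(2-6) by (simp_all add: homset_def)
  ultimately show ?thesis using assms(7) by metis
qed

lemma is_cokernel_unique:
  assumes "is_cokernel \<A> f c" "u \<in> Arr \<A>" "v \<in> Arr \<A>" "Dom \<A> u = Cod \<A> c" "Dom \<A> v = Cod \<A> c"
    "Cod \<A> u = Cod \<A> v" "u \<cdot> c = v \<cdot> c" and zero: "(u \<cdot> c) \<cdot> f = Zero \<A> (Dom \<A> f) (Cod \<A> u)"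
  shows "u = v"
proof -
  have "\<exists>!x. x \<in> homset \<A> (Cod \<A> c) (Cod \<A> u) \<and> x \<cdot> c = u \<cdot> c"
    using assms(1)[unfolded is_cokernel_def, THEN conjunct2, THEN conjunct2, THEN conjunct2,
        THEN conjunct2, rule_format, of "u \<cdot> c"] assms(1-4) zero
    by (simp add: is_cokernel_def)
  moreover have "u \<in> homset \<A> (Cod \<A> c) (Cod \<A> u)" "v \<in> homset \<A> (Cod \<A> c) (Cod \<A> u)"
    using assms(2-6) by (simp_all add: homset_def)
  ultimately show ?thesis using assms(7) by metis
qed

end

section \<open>Zero maps, negatives and cancellation in a preadditive category\<close>

context preadditive_category
begin

lemma Zero_simps [simp]:
  assumes "X \<in> Obj \<A>" "Y \<in> Obj \<A>"
  shows "Zero \<A> X Y \<in> Arr \<A>" "Dom \<A> (Zero \<A> X Y) = X" "Cod \<A> (Zero \<A> X Y) = Y"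
proof -
  interpret G: comm_group "hom_group \<A> X Y" using hom_group assms .
  from G.one_closed show "Zero \<A> X Y \<in> Arr \<A>" "Dom \<A> (Zero \<A> X Y) = X" "Cod \<A> (Zero \<A> X Y) = Y"
    by (auto simp: hom_group_def homset_def)
qed

lemma Plus_simps [simp]:
  assumes "f \<in> Arr \<A>" "g \<in> Arr \<A>" "Dom \<A> f = Dom \<A> g" "Cod \<A> f = Cod \<A> g"
  shows "f \<boxplus> g \<in> Arr \<A>" "Dom \<A> (f \<boxplus> g) = Dom \<A> g" "Cod \<A> (f \<boxplus> g) = Cod \<A> g"
proof -
  interpret G: comm_group "hom_group \<A> (Dom \<A> g) (Cod \<A> g)"
    using hom_group Dom_in Cod_in assms by blast
  from G.m_closed[of f g] assms
  show "f \<boxplus> g \<in> Arr \<A>" "Dom \<A> (f \<boxplus> g) = Dom \<A> g" "Cod \<A> (f \<boxplus> g) = Cod \<A> g"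
    by (auto simp: hom_group_def homset_def)
qed

lemma Plus_Zero [simp]:
  assumes "f \<in> Arr \<A>" "Dom \<A> f = X" "Cod \<A> f = Y"
  shows "f \<boxplus> Zero \<A> X Y = f" "Zero \<A> X Y \<boxplus> f = f"
proof -
  interpret G: comm_group "hom_group \<A> X Y"
    using hom_group Dom_in Cod_in assms by blast
  from G.r_one[of f] G.l_one[of f] assms show "f \<boxplus> Zero \<A> X Y = f" "Zero \<A> X Y \<boxplus> f = f"
    by (auto simp: hom_group_def homset_def)
qed

lemma Plus_right_cancel:
  assumes "f \<boxplus> h = g \<boxplus> h" "f \<in> Arr \<A>" "g \<in> Arr \<A>" "h \<in> Arr \<A>" "Dom \<A> f = Dom \<A> h"
    "Cod \<A> f = Cod \<A> h" "Dom \<A> g = Dom \<A> h" "Cod \<A> g = Cod \<A> h"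
  shows "f = g"
proof -
  interpret G: comm_group "hom_group \<A> (Dom \<A> h) (Cod \<A> h)"
    using hom_group Dom_in Cod_in assms by blast
  from G.right_cancel[of h f g] assms show ?thesis
    by (auto simp: hom_group_def homset_def)
qed

lemma ex_negative:
  assumes "f \<in> Arr \<A>"
  obtains f' where "f' \<in> Arr \<A>" "Dom \<A> f' = Dom \<A> f" "Cod \<A> f' = Cod \<A> f"
    "f \<boxplus> f' = Zero \<A> (Dom \<A> f) (Cod \<A> f)"
proof -
  interpret G: comm_group "hom_group \<A> (Dom \<A> f) (Cod \<A> f)"
    using hom_group Dom_in Cod_in assms by blast
  from G.r_inv[of f] G.inv_closed[of f] assms that show ?thesis
    by (auto simp: hom_group_def homset_def)
qed

lemma comp_Plus [simp]:
  assumes "f \<in> Arr \<A>" "f' \<in> Arr \<A>" "Dom \<A> f = Dom \<A> f'" "Cod \<A> f = Cod \<A> f'" "g \<in> Arr \<A>"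
  shows "Dom \<A> g = Cod \<A> f \<Longrightarrow> g \<cdot> (f \<boxplus> f') = g \<cdot> f \<boxplus> g \<cdot> f'"
    and "Cod \<A> g = Dom \<A> f \<Longrightarrow> (f \<boxplus> f') \<cdot> g = f \<cdot> g \<boxplus> f' \<cdot> g"
  using assms Comp_Plus_right[of f "Dom \<A> f" "Cod \<A> f" f' g "Cod \<A> g"]
    Comp_Plus_left[of g "Dom \<A> g" "Cod \<A> g" f "Cod \<A> f" f']
  by (auto simp: homset_def)

text \<open>This follows from distributivity alone: a zero map \<open>z\<close> satisfies
  \<open>z \<boxplus> z = z\<close>, so its image under composition is idempotent for the sum, and
  the group law cancels one copy.\<close>

lemma comp_Zero [simp]:
  assumes "f \<in> Arr \<A>" "X \<in> Obj \<A>"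
  shows "Dom \<A> f = Y \<Longrightarrow> f \<cdot> Zero \<A> X Y = Zero \<A> X (Cod \<A> f)"
    and "Cod \<A> f = Y \<Longrightarrow> Zero \<A> Y X \<cdot> f = Zero \<A> (Dom \<A> f) X"
proof -
  have O: "Dom \<A> f \<in> Obj \<A>" "Cod \<A> f \<in> Obj \<A>" using assms Dom_in Cod_in by auto
  show "f \<cdot> Zero \<A> X Y = Zero \<A> X (Cod \<A> f)" if Y: "Dom \<A> f = Y"
  proof -
    let ?z = "Zero \<A> X Y"
    have Yo: "Y \<in> Obj \<A>" using O Y by simp
    have "f \<cdot> ?z \<boxplus> f \<cdot> ?z = f \<cdot> (?z \<boxplus> ?z)"
      using assms Y Yo by (subst comp_Plus) auto
    also have "\<dots> = Zero \<A> X (Cod \<A> f) \<boxplus> f \<cdot> ?z" using assms O Y Yo by simp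
    finally show ?thesis
      by (rule Plus_right_cancel) (use assms O Y Yo in auto)
  qed
  show "Zero \<A> Y X \<cdot> f = Zero \<A> (Dom \<A> f) X" if Y: "Cod \<A> f = Y"
  proof -
    let ?z = "Zero \<A> Y X"
    have Yo: "Y \<in> Obj \<A>" using O Y by simp
    have "?z \<cdot> f \<boxplus> ?z \<cdot> f = (?z \<boxplus> ?z) \<cdot> f"
      using assms Y Yo by (subst comp_Plus) auto
    also have "\<dots> = Zero \<A> (Dom \<A> f) X \<boxplus> ?z \<cdot> f" using assms O Y Yo by simp
    finally show ?thesis
      by (rule Plus_right_cancel) (use assms O Y Yo in auto)
  qed
qed

text \<open>Two maps that agree after \<open>e\<close> have a difference killed by \<open>e\<close>,
  so it is enough to test against zero.\<close>

lemma is_epiI: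
  assumes "e \<in> Arr \<A>"
    and zero: "\<And>u. \<lbrakk>u \<in> Arr \<A>; Dom \<A> u = Cod \<A> e; u \<cdot> e = Zero \<A> (Dom \<A> e) (Cod \<A> u)\<rbrakk>
      \<Longrightarrow> u = Zero \<A> (Cod \<A> e) (Cod \<A> u)"
  shows "is_epi \<A> e"
  unfolding is_epi_def homset_def
proof (intro conjI allI ballI impI)
  fix W u v
  assume "u \<in> {h \<in> Arr \<A>. Dom \<A> h = Cod \<A> e \<and> Cod \<A> h = W}"
    and "v \<in> {h \<in> Arr \<A>. Dom \<A> h = Cod \<A> e \<and> Cod \<A> h = W}"
    and eq: "u \<cdot> e = v \<cdot> e"
  then have u: "u \<in> Arr \<A>" "Dom \<A> u = Cod \<A> e" and v: "v \<in> Arr \<A>" "Dom \<A> v = Cod \<A> e"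
    and C: "Cod \<A> u = Cod \<A> v" by auto
  obtain v' where v': "v' \<in> Arr \<A>" "Dom \<A> v' = Dom \<A> v" "Cod \<A> v' = Cod \<A> v"
    "v \<boxplus> v' = Zero \<A> (Dom \<A> v) (Cod \<A> v)" by (rule ex_negative[OF v(1)])
  have "(u \<boxplus> v') \<cdot> e = (v \<boxplus> v') \<cdot> e"
    using u v v'(1-3) C eq assms(1) by simp
  also have "\<dots> = Zero \<A> (Dom \<A> e) (Cod \<A> v)"
    using v' v assms(1) Cod_in by simp
  finally have "u \<boxplus> v' = Zero \<A> (Cod \<A> e) (Cod \<A> v)"
    using zero[of "u \<boxplus> v'"] u v v' C by simp
  then have "u \<boxplus> v' = v \<boxplus> v'" using v v' by simp
  then show "u = v" by (rule Plus_right_cancel) (use u v v' C in auto)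
qed (use assms in simp)

lemma is_cokernel_epi:
  assumes "is_cokernel \<A> f c"
  shows "is_epi \<A> c"
proof -
  have c: "c \<in> Arr \<A>" "f \<in> Arr \<A>" "Dom \<A> c = Cod \<A> f" "c \<cdot> f = Zero \<A> (Dom \<A> f) (Cod \<A> c)"
    using assms by (auto simp: is_cokernel_def)
  have O: "Dom \<A> f \<in> Obj \<A>" "Cod \<A> f \<in> Obj \<A>" "Cod \<A> c \<in> Obj \<A>" using c Dom_in Cod_in by auto
  show ?thesis
  proof (rule is_epiI)
    fix u assume u: "u \<in> Arr \<A>" "Dom \<A> u = Cod \<A> c" "u \<cdot> c = Zero \<A> (Dom \<A> c) (Cod \<A> u)"
    then show "u = Zero \<A> (Cod \<A> c) (Cod \<A> u)"
      by - (rule is_cokernel_unique[OF assms]; (use c O Cod_in[of u] in simp))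
  qed (rule c(1))
qed

lemma is_kernel_cancel:
  assumes "is_kernel \<A> f k" "u \<in> Arr \<A>" "v \<in> Arr \<A>" "Cod \<A> u = Dom \<A> k" "Cod \<A> v = Dom \<A> k"
    "Dom \<A> u = Dom \<A> v" "k \<cdot> u = k \<cdot> v"
  shows "u = v"
proof (rule is_kernel_unique[OF assms])
  have k: "k \<in> Arr \<A>" "f \<in> Arr \<A>" "Cod \<A> k = Dom \<A> f" "f \<cdot> k = Zero \<A> (Dom \<A> k) (Cod \<A> f)"
    using assms by (auto simp: is_kernel_def)
  show "f \<cdot> (k \<cdot> u) = Zero \<A> (Dom \<A> u) (Cod \<A> f)"
    using comp_reassoc[OF k(4), of u] k assms Cod_in by simp
qed

end

section \<open>Pull-backs and kernels in an abelian category\<close>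

context abelian_category
begin

text \<open>The epimorphism \<open>e\<close> is the cokernel of some \<open>f\<close>, and
  \<open>f\<close> factors through the kernel \<open>k\<close>. Hence a map that kills
  \<open>k\<close> kills \<open>f\<close> and factors through \<open>e\<close>, so \<open>e\<close>
  is also the cokernel of its own kernel.\<close>

lemma short_exactI:
  assumes e: "is_epi \<A> e" and k: "is_kernel \<A> e k"
  shows "short_exact \<A> k e"
proof -
  obtain f where f: "is_cokernel \<A> f e" using epi_is_cokernel e by blast
  have F: "f \<in> Arr \<A>" "e \<in> Arr \<A>" "Dom \<A> e = Cod \<A> f" "e \<cdot> f = Zero \<A> (Dom \<A> f) (Cod \<A> e)"
    using f by (auto simp: is_cokernel_def)
  have K: "k \<in> Arr \<A>" "Cod \<A> k = Dom \<A> e" "e \<cdot> k = Zero \<A> (Dom \<A> k) (Cod \<A> e)"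
    using k by (auto simp: is_kernel_def)
  obtain u where u: "u \<in> Arr \<A>" "Dom \<A> u = Dom \<A> f" "Cod \<A> u = Dom \<A> k" "k \<cdot> u = f"
    using is_kernelE[OF k, of f] F by metis
  have "is_cokernel \<A> k e"
    unfolding is_cokernel_def
  proof (intro conjI ballI impI)
    fix h assume h: "h \<in> Arr \<A>" "Dom \<A> h = Cod \<A> k \<and> h \<cdot> k = Zero \<A> (Dom \<A> k) (Cod \<A> h)"
    have "h \<cdot> f = Zero \<A> (Dom \<A> f) (Cod \<A> h)"
      using comp_reassoc[of h k _ u] h u K Cod_in by auto
    then show "\<exists>!u. u \<in> homset \<A> (Cod \<A> e) (Cod \<A> h) \<and> u \<cdot> e = h"
      using f h K F unfolding is_cokernel_def by auto
  qed (use F K in auto)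
  then show ?thesis using k by (simp add: short_exact_def)
qed

text \<open>The pull-back is the kernel of the difference of \<open>p\<close> and \<open>h\<close>
  on the biproduct of their domains. The conditional claim about epimorphisms is proved here because
  it needs this particular model.\<close>

lemma ex_pullback:
  assumes "p \<in> Arr \<A>" "h \<in> Arr \<A>" "Cod \<A> p = Cod \<A> h"
  obtains v q where "is_pullback \<A> p h v q" "is_epi \<A> p \<Longrightarrow> is_epi \<A> q"
proof -
  let ?X = "Dom \<A> p" and ?Y = "Dom \<A> h" and ?A = "Cod \<A> p"
  have O: "?X \<in> Obj \<A>" "?Y \<in> Obj \<A>" "?A \<in> Obj \<A>" using assms Dom_in Cod_in by auto
  obtain S i j r s where "is_biproduct \<A> ?X ?Y S i j r s" using ex_biproduct O by metis
  then have B: "i \<in> Arr \<A>" "Dom \<A> i = ?X" "Cod \<A> i = S" "j \<in> Arr \<A>" "Dom \<A> j = ?Y" "Cod \<A> j = S"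
    "r \<in> Arr \<A>" "Dom \<A> r = S" "Cod \<A> r = ?X" "s \<in> Arr \<A>" "Dom \<A> s = S" "Cod \<A> s = ?Y"
    and eqs: "r \<cdot> i = Idm \<A> ?X" "s \<cdot> j = Idm \<A> ?Y" "s \<cdot> i = Zero \<A> ?X ?Y" "r \<cdot> j = Zero \<A> ?Y ?X"
    and id: "i \<cdot> r \<boxplus> j \<cdot> s = Idm \<A> S"
    by (auto simp: is_biproduct_def homset_def)
  obtain h' where h': "h' \<in> Arr \<A>" "Dom \<A> h' = ?Y" "Cod \<A> h' = ?A" "h \<boxplus> h' = Zero \<A> ?Y ?A"
    using ex_negative[OF assms(2)] assms(3) by metis
  note R = comp_reassoc[OF eqs(1)] comp_reassoc[OF eqs(2)] comp_reassoc[OF eqs(3)] comp_reassoc[OF eqs(4)]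
  \<comment> \<open>With \<open>h'\<close> the negative of \<open>h\<close>, a pair of coordinates
    is killed by \<open>d\<close> exactly when it is compatible.\<close>
  define d where "d = p \<cdot> r \<boxplus> h' \<cdot> s"
  have d: "d \<in> Arr \<A>" "Dom \<A> d = S" "Cod \<A> d = ?A" using B h' assms by (auto simp: d_def)
  have di: "d \<cdot> i = p" using B h' assms eqs O by (simp add: d_def)
  obtain k where k: "is_kernel \<A> d k" using ex_kernel d by blast
  then have K: "k \<in> Arr \<A>" "Cod \<A> k = S" "d \<cdot> k = Zero \<A> (Dom \<A> k) ?A"
    using d by (auto simp: is_kernel_def)
  define v where "v = r \<cdot> k"
  define q where "q = s \<cdot> k"
  have V: "v \<in> Arr \<A>" "Dom \<A> v = Dom \<A> k" "Cod \<A> v = ?X"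
    and Q: "q \<in> Arr \<A>" "Dom \<A> q = Dom \<A> k" "Cod \<A> q = ?Y"
    using B K by (auto simp: v_def q_def)
  have Ko: "Dom \<A> k \<in> Obj \<A>" using K Dom_in by auto
  have neg: "h \<cdot> y \<boxplus> h' \<cdot> y = Zero \<A> (Dom \<A> y) ?A" if "y \<in> Arr \<A>" "Cod \<A> y = ?Y" for y
  proof -
    have "h \<cdot> y \<boxplus> h' \<cdot> y = (h \<boxplus> h') \<cdot> y" using that h'(1-3) assms by simp
    then show ?thesis using that h' O by simp
  qed
  have dz: "d \<cdot> z = p \<cdot> (r \<cdot> z) \<boxplus> h' \<cdot> (s \<cdot> z)" if "z \<in> Arr \<A>" "Cod \<A> z = S" for z
    using that B h' assms by (simp add: d_def)
  have comm: "p \<cdot> v = h \<cdot> q"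
  proof (rule Plus_right_cancel)
    show "p \<cdot> v \<boxplus> h' \<cdot> q = h \<cdot> q \<boxplus> h' \<cdot> q"
      using dz[OF K(1,2)] neg[OF Q(1,3)] K V Q by (simp add: v_def q_def)
  qed (use V Q assms h' in auto)
  have pb: "is_pullback \<A> p h v q"
    unfolding is_pullback_def
  proof (intro conjI allI ballI impI)
    fix W x y
    assume "x \<in> homset \<A> W ?X" "y \<in> homset \<A> W ?Y" and eq: "p \<cdot> x = h \<cdot> y"
    then have x: "x \<in> Arr \<A>" "Dom \<A> x = W" "Cod \<A> x = ?X" and y: "y \<in> Arr \<A>" "Dom \<A> y = W" "Cod \<A> y = ?Y"
      by (auto simp: homset_def)
    define z where "z = i \<cdot> x \<boxplus> j \<cdot> y"
    have z: "z \<in> Arr \<A>" "Dom \<A> z = W" "Cod \<A> z = S" using B x y by (auto simp: z_def)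
    have Wo: "W \<in> Obj \<A>" using x Dom_in by auto
    have rz: "r \<cdot> z = x" and sz: "s \<cdot> z = y" using B x y O Wo by (auto simp: z_def R)
    have "d \<cdot> z = Zero \<A> W ?A" using dz[OF z(1,3)] neg[OF y(1,3)] rz sz eq y by simp
    then obtain w where w: "w \<in> Arr \<A>" "Dom \<A> w = W" "Cod \<A> w = Dom \<A> k" "k \<cdot> w = z"
      using is_kernelE[OF k, of z] z d by metis
    show "\<exists>!w. w \<in> homset \<A> W (Dom \<A> v) \<and> v \<cdot> w = x \<and> q \<cdot> w = y"
    proof (rule ex1I[of _ w])
      show "w \<in> homset \<A> W (Dom \<A> v) \<and> v \<cdot> w = x \<and> q \<cdot> w = y"
        using w V B K rz sz by (simp add: homset_def v_def q_def)
      fix w' assume "w' \<in> homset \<A> W (Dom \<A> v) \<and> v \<cdot> w' = x \<and> q \<cdot> w' = y"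
      then have w': "w' \<in> Arr \<A>" "Dom \<A> w' = W" "Cod \<A> w' = Dom \<A> k" "r \<cdot> (k \<cdot> w') = x" "s \<cdot> (k \<cdot> w') = y"
        using V B K by (auto simp: homset_def v_def q_def)
      \<comment> \<open>The decomposition of the identity recovers \<open>k \<cdot> w'\<close> from
        its two coordinates; then \<open>k\<close> can be cancelled.\<close>
      have "k \<cdot> w' = (i \<cdot> r \<boxplus> j \<cdot> s) \<cdot> (k \<cdot> w')" using id w' K B Cod_in by simp
      also have "\<dots> = z" using w' K B by (simp add: z_def)
      finally show "w' = w" by - (rule is_kernel_cancel[OF k]; (use w w' in auto))
    qed
  qed (use V Q assms comm in auto)
  have "is_epi \<A> q" if p: "is_epi \<A> p"
  proof (rule is_epiI)
    fix u assume u: "u \<in> Arr \<A>" "Dom \<A> u = Cod \<A> q" "u \<cdot> q = Zero \<A> (Dom \<A> q) (Cod \<A> u)"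
    have U: "Cod \<A> u \<in> Obj \<A>" using u Cod_in by auto
    \<comment> \<open>Being epi, \<open>d\<close> is the cokernel of \<open>k\<close>. As
      \<open>u \<cdot> q\<close> is zero, \<open>u \<cdot> s\<close> kills \<open>k\<close> and
      equals some \<open>w \<cdot> d\<close>. Restricting along \<open>i\<close> gives
      \<open>w \<cdot> p = 0\<close>, so \<open>w\<close> vanishes; restricting along
      \<open>j\<close> then gives \<open>u = 0\<close>.\<close>
    have "is_epi \<A> d" using is_epi_cancel[of d i] di p d B by simp
    then have "is_cokernel \<A> k d" using short_exactI k by (simp add: short_exact_def)
    moreover have "(u \<cdot> s) \<cdot> k = Zero \<A> (Dom \<A> k) (Cod \<A> (u \<cdot> s))"
      using u Q B K by (simp add: q_def)
    ultimately obtain w where w: "w \<in> Arr \<A>" "Dom \<A> w = ?A" "Cod \<A> w = Cod \<A> u" "w \<cdot> d = u \<cdot> s"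
      using is_cokernelE[of k d "u \<cdot> s"] u Q B K d by auto
    have "w \<cdot> p = (u \<cdot> s) \<cdot> i" using comp_reassoc[OF w(4), of i] w d di B by simp
    also have "\<dots> = Zero \<A> ?A (Cod \<A> u) \<cdot> p" using u Q B eqs O U assms by simp
    finally have "w = Zero \<A> ?A (Cod \<A> u)"
      by - (rule is_epiD[OF p]; (use w U O in auto))
    then have "u \<cdot> s = Zero \<A> S (Cod \<A> u)" using w d U by simp
    then have "(u \<cdot> s) \<cdot> j = Zero \<A> ?Y (Cod \<A> u)" using U B by simp
    then show "u = Zero \<A> (Cod \<A> q) (Cod \<A> u)" using u Q B eqs by simp
  qed (rule Q(1))
  with pb that show ?thesis by blast
qed

text \<open>Any pull-back receives a comparison map from the constructed one. The projection
  \<open>q'\<close> is epi there and factors through \<open>q\<close>, so \<open>q\<close> is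
  epi.\<close>

lemma is_pullback_epi:
  assumes pb: "is_pullback \<A> p h v q" and p: "is_epi \<A> p"
  shows "is_epi \<A> q"
proof -
  have P: "p \<in> Arr \<A>" "h \<in> Arr \<A>" "Cod \<A> p = Cod \<A> h" "q \<in> Arr \<A>" "Dom \<A> v = Dom \<A> q"
    using pb by (auto simp: is_pullback_def)
  obtain v' q' where *: "is_pullback \<A> p h v' q'" "is_epi \<A> q'"
    using ex_pullback[OF P(1-3)] p by metis
  then have P': "v' \<in> Arr \<A>" "q' \<in> Arr \<A>" "Cod \<A> v' = Dom \<A> p" "Cod \<A> q' = Dom \<A> h" "Dom \<A> v' = Dom \<A> q'"
    "p \<cdot> v' = h \<cdot> q'"
    by (auto simp: is_pullback_def)
  obtain w where w: "w \<in> Arr \<A>" "Dom \<A> w = Dom \<A> v'" "Cod \<A> w = Dom \<A> v" "v \<cdot> w = v'" "q \<cdot> w = q'"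
    using is_pullbackE[OF pb P'] by blast
  then show ?thesis using is_epi_cancel[of q w] * P by simp
qed

text \<open>If \<open>q\<close> kills \<open>x\<close>, then \<open>p\<close> kills
  \<open>v \<cdot> x\<close>, which therefore factors through \<open>i\<close>. The resulting lift
  agrees with \<open>x\<close> on both legs of the pull-back. Thus \<open>p\<close> and
  \<open>q\<close> have the same kernel object.\<close>

lemma is_pullback_kernel:
  assumes pb: "is_pullback \<A> p h v q" and k: "is_kernel \<A> p i"
    and i': "i' \<in> homset \<A> (Dom \<A> i) (Dom \<A> v)" "v \<cdot> i' = i" "q \<cdot> i' = Zero \<A> (Dom \<A> i) (Dom \<A> h)"
  shows "is_kernel \<A> q i'"
proof -
  have P: "p \<in> Arr \<A>" "h \<in> Arr \<A>" "Cod \<A> p = Cod \<A> h" "q \<in> Arr \<A>" "Dom \<A> v = Dom \<A> q" "v \<in> Arr \<A>"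
    "Cod \<A> v = Dom \<A> p" "Cod \<A> q = Dom \<A> h" "p \<cdot> v = h \<cdot> q"
    using pb by (auto simp: is_pullback_def)
  have I: "i' \<in> Arr \<A>" "Dom \<A> i' = Dom \<A> i" "Cod \<A> i' = Dom \<A> q" using i' P by (auto simp: homset_def)
  have K: "i \<in> Arr \<A>" "Cod \<A> i = Dom \<A> p" using k by (auto simp: is_kernel_def)
  show ?thesis
    unfolding is_kernel_def
  proof (intro conjI ballI impI)
    fix x assume x: "x \<in> Arr \<A>" "Cod \<A> x = Dom \<A> q \<and> q \<cdot> x = Zero \<A> (Dom \<A> x) (Cod \<A> q)"
    have "p \<cdot> (v \<cdot> x) = Zero \<A> (Dom \<A> (v \<cdot> x)) (Cod \<A> p)"
      using comp_reassoc[OF P(9), of x] x P Dom_in by simp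
    then obtain u where u: "u \<in> Arr \<A>" "Dom \<A> u = Dom \<A> x" "Cod \<A> u = Dom \<A> i" "i \<cdot> u = v \<cdot> x"
      using is_kernelE[OF k, of "v \<cdot> x"] x P by auto
    have ux: "i' \<cdot> u = x"
    proof (rule is_pullback_unique[OF pb])
      show "v \<cdot> (i' \<cdot> u) = v \<cdot> x" using comp_reassoc[OF i'(2), of u] u I P by simp
      show "q \<cdot> (i' \<cdot> u) = q \<cdot> x" using comp_reassoc[OF i'(3), of u] u I P x Dom_in by simp
    qed (use u I x P in auto)
    have uniq: "y = u" if y: "y \<in> Arr \<A>" "Dom \<A> y = Dom \<A> x" "Cod \<A> y = Dom \<A> i" "i' \<cdot> y = x" for y
    proof (rule is_kernel_cancel[OF k])
      show "i \<cdot> y = i \<cdot> u" using comp_reassoc[OF i'(2), of y] u I P y by simp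
    qed (use y u in auto)
    show "\<exists>!u. u \<in> homset \<A> (Dom \<A> x) (Dom \<A> i') \<and> i' \<cdot> u = x"
      unfolding I(2) by (rule ex1_homsetI[OF u(1-3) ux uniq])
  qed (use I i' P in auto)
qed

text \<open>The pair formed by \<open>i\<close> and zero is compatible because
  \<open>p \<cdot> i\<close> is zero.\<close>

lemma ex_pullback_kernel:
  assumes pb: "is_pullback \<A> p h v q" and k: "is_kernel \<A> p i"
  obtains i' where "i' \<in> homset \<A> (Dom \<A> i) (Dom \<A> v)" "v \<cdot> i' = i" "q \<cdot> i' = Zero \<A> (Dom \<A> i) (Dom \<A> h)"
proof -
  have P: "p \<in> Arr \<A>" "h \<in> Arr \<A>" "Cod \<A> p = Cod \<A> h"
    using pb by (auto simp: is_pullback_def)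
  have K: "i \<in> Arr \<A>" "Cod \<A> i = Dom \<A> p" "p \<cdot> i = Zero \<A> (Dom \<A> i) (Cod \<A> p)"
    using k by (auto simp: is_kernel_def)
  show ?thesis
    using is_pullbackE[OF pb, of i "Zero \<A> (Dom \<A> i) (Dom \<A> h)"] K P Dom_in that
    by (auto simp: homset_def)
qed

end

section \<open>Conflations: pull-back and composition of deflations\<close>

context extension_closed_subcategory
begin

lemma in_Obj: "X \<in> \<C> \<Longrightarrow> X \<in> Obj \<A>"
  using subset_Obj by blast

lemma conflationD:
  assumes "conflation \<A> \<C> i p"
  shows "i \<in> Arr \<A>" "p \<in> Arr \<A>" "Cod \<A> i = Dom \<A> p" "p \<cdot> i = Zero \<A> (Dom \<A> i) (Cod \<A> p)"
    "is_kernel \<A> p i" "is_cokernel \<A> i p" "is_epi \<A> p" "Dom \<A> i \<in> \<C>" "Dom \<A> p \<in> \<C>" "Cod \<A> p \<in> \<C>"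
proof -
  show *: "is_kernel \<A> p i" "is_cokernel \<A> i p" "Dom \<A> i \<in> \<C>" "Dom \<A> p \<in> \<C>" "Cod \<A> p \<in> \<C>"
    using assms by (simp_all add: conflation_def short_exact_def)
  show "is_epi \<A> p" using *(2) by (rule is_cokernel_epi)
  show "i \<in> Arr \<A>" "p \<in> Arr \<A>" "Cod \<A> i = Dom \<A> p" "p \<cdot> i = Zero \<A> (Dom \<A> i) (Cod \<A> p)"
    using *(1) by (simp_all add: is_kernel_def)
qed

text \<open>The pulled-back middle term is an extension of \<open>Dom \<A> h\<close> by
  \<open>Dom \<A> i\<close>, so extension-closure places it in \<open>\<C>\<close>.\<close>

lemma pullback_conflation:
  assumes "is_pullback \<A> p h v q" "conflation \<A> \<C> i p" "Dom \<A> h \<in> \<C>"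
    "i' \<in> homset \<A> (Dom \<A> i) (Dom \<A> v)" "v \<cdot> i' = i" "q \<cdot> i' = Zero \<A> (Dom \<A> i) (Dom \<A> h)"
  shows "conflation \<A> \<C> i' q"
proof -
  note c = conflationD[OF assms(2)]
  have "short_exact \<A> i' q"
    using is_pullback_epi[OF assms(1) c(7)] is_pullback_kernel[OF assms(1) c(5) assms(4-6)]
    by (rule short_exactI)
  moreover have "Cod \<A> q = Dom \<A> h" "Dom \<A> i' = Dom \<A> i"
    using assms by (auto simp: is_pullback_def homset_def)
  ultimately show ?thesis
    using extension_in c assms(3) by (simp add: conflation_def)
qed

lemma ex_pullback_conflation:
  assumes "conflation \<A> \<C> i p" "h \<in> Arr \<A>" "Cod \<A> h = Cod \<A> p" "Dom \<A> h \<in> \<C>"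
  obtains v i' q where "is_pullback \<A> p h v q" "conflation \<A> \<C> i' q"
    "i' \<in> homset \<A> (Dom \<A> i) (Dom \<A> v)" "v \<cdot> i' = i" "q \<cdot> i' = Zero \<A> (Dom \<A> i) (Dom \<A> h)"
proof -
  note c = conflationD[OF assms(1)]
  obtain v q where pb: "is_pullback \<A> p h v q"
    using ex_pullback[OF c(2) assms(2) assms(3)[symmetric]] by blast
  obtain i' where i': "i' \<in> homset \<A> (Dom \<A> i) (Dom \<A> v)" "v \<cdot> i' = i" "q \<cdot> i' = Zero \<A> (Dom \<A> i) (Dom \<A> h)"
    using ex_pullback_kernel[OF pb c(5)] by blast
  then show ?thesis
    using that pb pullback_conflation[OF pb assms(1,4)] by blast
qed

text \<open>The kernel of a composite \<open>p \<cdot> q\<close> of deflations is the pull-back of \<open>q\<close> along the kernel of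
  \<open>p\<close>, hence an extension of objects of \<open>\<C>\<close>.\<close>

lemma conflation_comp:
  assumes ip: "conflation \<A> \<C> i p" and jq: "conflation \<A> \<C> j q" and qp: "Cod \<A> q = Dom \<A> p"
  obtains v q' where "conflation \<A> \<C> v (p \<cdot> q)" "q' \<in> homset \<A> (Dom \<A> v) (Dom \<A> i)" "q \<cdot> v = i \<cdot> q'"
proof -
  note c = conflationD[OF ip] and d = conflationD[OF jq]
  obtain v j' q' where pb: "is_pullback \<A> q i v q'" and c': "conflation \<A> \<C> j' q'"
    using ex_pullback_conflation[OF jq, of i] c qp by metis
  then have P: "v \<in> Arr \<A>" "q' \<in> Arr \<A>" "Cod \<A> v = Dom \<A> q" "Cod \<A> q' = Dom \<A> i" "Dom \<A> v = Dom \<A> q'"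
    "q \<cdot> v = i \<cdot> q'"
    by (auto simp: is_pullback_def)
  have "is_kernel \<A> (p \<cdot> q) v"
    unfolding is_kernel_def
  proof (intro conjI ballI impI)
    have "p \<cdot> (q \<cdot> v) = Zero \<A> (Dom \<A> v) (Cod \<A> p)"
      using comp_reassoc[OF c(4), of q'] c P Cod_in by simp
    then show "(p \<cdot> q) \<cdot> v = Zero \<A> (Dom \<A> v) (Cod \<A> (p \<cdot> q))" using c d P qp by simp
    fix x assume x: "x \<in> Arr \<A>" "Cod \<A> x = Dom \<A> (p \<cdot> q) \<and> (p \<cdot> q) \<cdot> x = Zero \<A> (Dom \<A> x) (Cod \<A> (p \<cdot> q))"
    then have "Cod \<A> x = Dom \<A> q" using d c qp by simp
    with x have qx: "q \<cdot> x \<in> Arr \<A>" "Dom \<A> (q \<cdot> x) = Dom \<A> x" "Cod \<A> (q \<cdot> x) = Dom \<A> p"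
      "p \<cdot> (q \<cdot> x) = Zero \<A> (Dom \<A> (q \<cdot> x)) (Cod \<A> p)"
      using c d qp by simp_all
    obtain u where u: "u \<in> Arr \<A>" "Dom \<A> u = Dom \<A> x" "Cod \<A> u = Dom \<A> i" "i \<cdot> u = q \<cdot> x"
      using is_kernelE[OF c(5) qx(1,3,4)] qx(2) by metis
    obtain w where w: "w \<in> Arr \<A>" "Dom \<A> w = Dom \<A> x" "Cod \<A> w = Dom \<A> v" "v \<cdot> w = x" "q' \<cdot> w = u"
      by (rule is_pullbackE[OF pb, of x u]) (use x u c d qp in simp_all)
    have uniq: "y = w" if y: "y \<in> Arr \<A>" "Dom \<A> y = Dom \<A> x" "Cod \<A> y = Dom \<A> v" "v \<cdot> y = x" for y
    proof (rule is_pullback_unique[OF pb])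
      show "q' \<cdot> y = q' \<cdot> w"
      proof (rule is_kernel_cancel[OF c(5)])
        show "i \<cdot> (q' \<cdot> y) = i \<cdot> (q' \<cdot> w)"
          using comp_reassoc[OF P(6), of y] comp_reassoc[OF P(6), of w] y w P c d qp by simp
      qed (use y w P in auto)
    qed (use y w in auto)
    show "\<exists>!u. u \<in> homset \<A> (Dom \<A> x) (Dom \<A> v) \<and> v \<cdot> u = x"
      by (rule ex1_homsetI[OF w(1-4) uniq])
  qed (use c d P qp in auto)
  then have "short_exact \<A> v (p \<cdot> q)"
    using short_exactI is_epi_comp c d qp by simp
  then have "conflation \<A> \<C> v (p \<cdot> q)"
    using c d qp P conflationD[OF c'] by (simp add: conflation_def)
  then show ?thesis using that[of v q'] P by (simp add: homset_def)
qed

end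

section \<open>Opposite category\<close>

definition op_cat :: "('o, 'm) precat \<Rightarrow> ('o, 'm) precat" where
  "op_cat \<A> = \<lparr>Obj = Obj \<A>, Arr = Arr \<A>, Dom = Cod \<A>, Cod = Dom \<A>, Idm = Idm \<A>,
    Comp = (\<lambda>g f. f \<cdot>\<^bsub>\<A>\<^esub> g), Plus = Plus \<A>, Zero = (\<lambda>X Y. Zero \<A> Y X)\<rparr>"

lemma op_cat_simps [simp]:
  "Obj (op_cat \<A>) = Obj \<A>" "Arr (op_cat \<A>) = Arr \<A>" "Dom (op_cat \<A>) = Cod \<A>"
  "Cod (op_cat \<A>) = Dom \<A>" "Idm (op_cat \<A>) = Idm \<A>" "g \<cdot>\<^bsub>op_cat \<A>\<^esub> f = f \<cdot>\<^bsub>\<A>\<^esub> g"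
  "Plus (op_cat \<A>) = Plus \<A>" "Zero (op_cat \<A>) X Y = Zero \<A> Y X"
  by (simp_all add: op_cat_def)

text \<open>Literal equality, not just isomorphism: each duality fact can be instantiated at
  \<open>op_cat \<A>\<close> to obtain its converse or its mirror image.\<close>

lemma op_cat_op_cat [simp]: "op_cat (op_cat \<A>) = \<A>"
  by (simp add: op_cat_def)

lemma homset_op_cat [simp]: "homset (op_cat \<A>) X Y = homset \<A> Y X"
  by (auto simp: homset_def)

lemma hom_group_op_cat: "hom_group (op_cat \<A>) X Y = hom_group \<A> Y X"
  by (simp add: hom_group_def)

lemma is_zero_object_op_cat: "is_zero_object (op_cat \<A>) Z \<longleftrightarrow> is_zero_object \<A> Z"
  unfolding is_zero_object_def by auto

lemma is_biproduct_op_cat: "is_biproduct (op_cat \<A>) X Y S i j p q \<longleftrightarrow> is_biproduct \<A> X Y S p q i j"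
  unfolding is_biproduct_def by auto

lemma is_kernel_op_cat: "is_kernel (op_cat \<A>) = is_cokernel \<A>"
  unfolding is_cokernel_def is_kernel_def by (intro ext) simp

lemma is_cokernel_op_cat: "is_cokernel (op_cat \<A>) = is_kernel \<A>"
  using is_kernel_op_cat[of "op_cat \<A>"] by simp

lemma is_mono_op_cat: "is_mono (op_cat \<A>) = is_epi \<A>"
  unfolding is_epi_def is_mono_def by (intro ext) simp

lemma is_epi_op_cat: "is_epi (op_cat \<A>) = is_mono \<A>"
  using is_mono_op_cat[of "op_cat \<A>"] by simp

lemma short_exact_op_cat: "short_exact (op_cat \<A>) i p \<longleftrightarrow> short_exact \<A> p i"
  by (auto simp: short_exact_def is_kernel_op_cat is_cokernel_op_cat)

lemma is_pullback_op_cat: "is_pullback (op_cat \<A>) = is_pushout \<A>"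
  unfolding is_pushout_def is_pullback_def by (intro ext) simp

lemma is_pushout_op_cat: "is_pushout (op_cat \<A>) = is_pullback \<A>"
  using is_pullback_op_cat[of "op_cat \<A>"] by simp

text \<open>The definition names the middle term as the domain of the deflation, which dualizes to
  the codomain of the inflation. Exactness identifies the two.\<close>

lemma conflation_op_cat: "conflation (op_cat \<A>) \<C> i p \<longleftrightarrow> conflation \<A> \<C> p i"
proof -
  have "Cod \<A> p = Dom \<A> i" if "short_exact \<A> p i"
    using that by (simp add: short_exact_def is_kernel_def)
  then show ?thesis
    by (auto simp: conflation_def short_exact_op_cat)
qed

lemma (in category) category_op_cat: "category (op_cat \<A>)"
  by unfold_locales
    (simp_all add: Dom_in Cod_in Idm_in Comp_in Comp_assoc Comp_Idm_left Comp_Idm_right)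

lemma (in preadditive_category) preadditive_category_op_cat: "preadditive_category (op_cat \<A>)"
  by (intro preadditive_category.intro preadditive_category_axioms.intro category_op_cat)
    (simp_all add: hom_group_op_cat hom_group Comp_Plus_right Comp_Plus_left)

lemma (in abelian_category) abelian_category_op_cat: "abelian_category (op_cat \<A>)"
proof -
  interpret D: preadditive_category "op_cat \<A>" by (rule preadditive_category_op_cat)
  show ?thesis
  proof unfold_locales
    show "\<exists>S i j p q. is_biproduct (op_cat \<A>) X Y S i j p q"
      if "X \<in> Obj (op_cat \<A>)" "Y \<in> Obj (op_cat \<A>)" for X Y
      using ex_biproduct[of X Y] that unfolding is_biproduct_op_cat op_cat_simps by blast
  qed (simp_all add: is_zero_object_op_cat ex_zero_object is_kernel_op_cat is_cokernel_op_cat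
      is_mono_op_cat is_epi_op_cat ex_kernel ex_cokernel mono_is_kernel epi_is_cokernel)
qed

lemma (in extension_closed_subcategory) extension_closed_subcategory_op_cat:
  "extension_closed_subcategory (op_cat \<A>) \<C>"
proof -
  interpret D: abelian_category "op_cat \<A>" by (rule abelian_category_op_cat)
  show ?thesis
  proof unfold_locales
    show "\<exists>S\<in>\<C>. \<exists>i j p q. is_biproduct (op_cat \<A>) X Y S i j p q" if "X \<in> \<C>" "Y \<in> \<C>" for X Y
      using biproduct_in[OF that] unfolding is_biproduct_op_cat by blast
    show "Dom (op_cat \<A>) p \<in> \<C>"
      if "short_exact (op_cat \<A>) i p" "Dom (op_cat \<A>) i \<in> \<C>" "Cod (op_cat \<A>) p \<in> \<C>" for i p
    proof -
      have "short_exact \<A> p i" using that(1) by (simp add: short_exact_op_cat)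
      moreover from this have "Cod \<A> p = Dom \<A> i" by (simp add: short_exact_def is_kernel_def)
      ultimately show ?thesis using extension_in[of p i] that(2,3) by simp
    qed
  qed (simp_all add: subset_Obj is_zero_object_op_cat zero_object_in)
qed

section \<open>Push-outs, read off from pull-backs in the opposite category\<close>

context extension_closed_subcategory
begin

lemma pushout_conflation:
  assumes "is_pushout \<A> b g u b'" "conflation \<A> \<C> b p" "Cod \<A> g \<in> \<C>"
    "p' \<in> homset \<A> (Cod \<A> u) (Cod \<A> p)" "p' \<cdot> u = p" "p' \<cdot> b' = Zero \<A> (Cod \<A> g) (Cod \<A> p)"
  shows "conflation \<A> \<C> b' p'"
proof -
  interpret D: extension_closed_subcategory "op_cat \<A>" \<C>
    by (rule extension_closed_subcategory_op_cat)
  show ?thesis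
    using D.pullback_conflation[of b g u b' p p'] assms
    by (simp add: is_pullback_op_cat conflation_op_cat)
qed

lemma ex_pushout_cokernel:
  assumes "is_pushout \<A> b g u b'" "is_cokernel \<A> b p"
  obtains p' where "p' \<in> homset \<A> (Cod \<A> u) (Cod \<A> p)" "p' \<cdot> u = p"
    "p' \<cdot> b' = Zero \<A> (Cod \<A> g) (Cod \<A> p)"
proof -
  interpret D: extension_closed_subcategory "op_cat \<A>" \<C>
    by (rule extension_closed_subcategory_op_cat)
  show ?thesis
    using D.ex_pullback_kernel[of b g u b' p] assms that
    by (auto simp: is_pullback_op_cat is_kernel_op_cat)
qed

lemma ex_pushout:
  assumes "b \<in> Arr \<A>" "g \<in> Arr \<A>" "Dom \<A> b = Dom \<A> g"
  obtains u b' where "is_pushout \<A> b g u b'"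
proof -
  interpret D: extension_closed_subcategory "op_cat \<A>" \<C>
    by (rule extension_closed_subcategory_op_cat)
  show ?thesis
    using D.ex_pullback[of b g] assms that by (auto simp: is_pullback_op_cat)
qed

lemma is_pushout_unique:
  assumes "is_pushout \<A> b g u b'" "w \<in> Arr \<A>" "w' \<in> Arr \<A>" "Dom \<A> w = Cod \<A> u" "Dom \<A> w' = Cod \<A> u"
    "Cod \<A> w = Cod \<A> w'" "w \<cdot> u = w' \<cdot> u" "w \<cdot> b' = w' \<cdot> b'"
  shows "w = w'"
proof -
  interpret D: extension_closed_subcategory "op_cat \<A>" \<C>
    by (rule extension_closed_subcategory_op_cat)
  show ?thesis
    using D.is_pullback_unique[of b g u b' w w'] assms by (simp add: is_pullback_op_cat)
qed

end

section \<open>Long conflations and morphisms between them\<close>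

text \<open>Turns the entrywise conditions in \<open>long_conflations\<close> into one list
  equation, so that entries can be computed. The two end maps are not composites and need their own
  cases.\<close>

definition splice_seq :: "('o, 'm) precat \<Rightarrow> nat \<Rightarrow> (nat \<Rightarrow> 'm) \<Rightarrow> (nat \<Rightarrow> 'm) \<Rightarrow> 'm list" where
  "splice_seq \<A> t i p =
    map (\<lambda>j. if j = 0 then p 0 else if j = t then i (t - 1) else i (j - 1) \<cdot>\<^bsub>\<A>\<^esub> p j) [0..<Suc t]"

lemma length_splice_seq [simp]: "length (splice_seq \<A> t i p) = t + 1"
  by (simp add: splice_seq_def)

lemma nth_splice_seq:
  "j \<le> t \<Longrightarrow> splice_seq \<A> t i p ! j =
    (if j = 0 then p 0 else if j = t then i (t - 1) else i (j - 1) \<cdot>\<^bsub>\<A>\<^esub> p j)"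
  unfolding splice_seq_def by (subst nth_map) (simp_all del: upt_Suc)

lemma long_conflations_iff:
  "E \<in> long_conflations \<A> \<C> t A B \<longleftrightarrow> 1 \<le> t \<and>
    (\<exists>K i p. K 0 = A \<and> K t = B \<and> E = splice_seq \<A> t i p \<and>
      (\<forall>j<t. conflation \<A> \<C> (i j) (p j) \<and> Dom \<A> (i j) = K (j + 1) \<and> Cod \<A> (p j) = K j))"
proof -
  have "length E = t + 1 \<and> E ! 0 = p 0 \<and> E ! t = i (t - 1) \<and>
      (\<forall>j. 0 < j \<and> j < t \<longrightarrow> E ! j = i (j - 1) \<cdot>\<^bsub>\<A>\<^esub> p j) \<longleftrightarrow> E = splice_seq \<A> t i p"
    if "1 \<le> t" for i p
  proof
    assume *: "length E = t + 1 \<and> E ! 0 = p 0 \<and> E ! t = i (t - 1) \<and>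
      (\<forall>j. 0 < j \<and> j < t \<longrightarrow> E ! j = i (j - 1) \<cdot>\<^bsub>\<A>\<^esub> p j)"
    show "E = splice_seq \<A> t i p"
    proof (rule nth_equalityI)
      fix j assume "j < length E"
      then have "j \<le> t" using * by simp
      then show "E ! j = splice_seq \<A> t i p ! j" using * that by (auto simp: nth_splice_seq)
    qed (use * in simp)
  qed (use that in \<open>auto simp: nth_splice_seq\<close>)
  then show ?thesis unfolding long_conflations_def by blast
qed

text \<open>\<open>yoneda_step\<close> is the case where \<open>g\<close> is an identity.\<close>

definition seq_map :: "('o, 'm) precat \<Rightarrow> nat \<Rightarrow> 'm \<Rightarrow> 'm list \<Rightarrow> 'm list \<Rightarrow> bool" where
  "seq_map \<A> t g E E' \<longleftrightarrow>
    (\<exists>\<phi>. (\<forall>j<t. \<phi> j \<in> homset \<A> (Dom \<A> (E ! j)) (Dom \<A> (E' ! j))) \<and>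
      E' ! 0 \<cdot>\<^bsub>\<A>\<^esub> \<phi> 0 = E ! 0 \<and> \<phi> (t - 1) \<cdot>\<^bsub>\<A>\<^esub> (E ! t) = E' ! t \<cdot>\<^bsub>\<A>\<^esub> g \<and>
      (\<forall>j. 0 < j \<and> j < t \<longrightarrow> E' ! j \<cdot>\<^bsub>\<A>\<^esub> \<phi> j = \<phi> (j - 1) \<cdot>\<^bsub>\<A>\<^esub> (E ! j)))"

context extension_closed_subcategory
begin

lemma long_conflationsD:
  assumes E: "E \<in> long_conflations \<A> \<C> t A B"
  shows "1 \<le> t" "length E = t + 1" "A \<in> \<C>" "B \<in> \<C>"
    and "\<And>j. j \<le> t \<Longrightarrow> E ! j \<in> Arr \<A>"
    and "Cod \<A> (E ! 0) = A" "Dom \<A> (E ! t) = B"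
    and "\<And>j. 0 < j \<Longrightarrow> j \<le> t \<Longrightarrow> Cod \<A> (E ! j) = Dom \<A> (E ! (j - 1))"
    and "E ! (t - 1) \<cdot> (E ! t) = Zero \<A> B (Cod \<A> (E ! (t - 1)))"
proof -
  obtain K i p where t: "1 \<le> t" and K: "K 0 = A" "K t = B" and eq: "E = splice_seq \<A> t i p"
    and c: "\<And>j. j < t \<Longrightarrow> conflation \<A> \<C> (i j) (p j)" "\<And>j. j < t \<Longrightarrow> Dom \<A> (i j) = K (j + 1)"
      "\<And>j. j < t \<Longrightarrow> Cod \<A> (p j) = K j"
    using E unfolding long_conflations_iff by blast
  note d = conflationD[OF c(1)]
  define s where "s = t - 1"
  have s: "t = Suc s" using t by (simp add: s_def)
  show "1 \<le> t" "length E = t + 1" using t eq by simp_all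
  show "A \<in> \<C>" using d(10)[of 0] c(3)[of 0] K t by simp
  show "B \<in> \<C>" using d(8)[of s] c(2)[of s] K s by simp
  have D: "Dom \<A> (E ! j) = Dom \<A> (p j)" if "j < t" for j
    using that d(1,2,3) c(2,3) by (cases j) (auto simp: eq nth_splice_seq)
  show "E ! j \<in> Arr \<A>" if "j \<le> t" for j
    using that t d(1,2) c(2,3) by (cases j) (auto simp: eq nth_splice_seq)
  show "Cod \<A> (E ! 0) = A" "Dom \<A> (E ! t) = B"
    using K t c(3)[of 0] c(2)[of s] s by (auto simp: eq nth_splice_seq)
  show "Cod \<A> (E ! j) = Dom \<A> (E ! (j - 1))" if "0 < j" "j \<le> t" for j
    using that d(1,2,3) c(2,3) by (cases j) (auto simp: D, auto simp: eq nth_splice_seq)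
  show "E ! (t - 1) \<cdot> (E ! t) = Zero \<A> B (Cod \<A> (E ! (t - 1)))"
  proof (cases s)
    case 0
    then show ?thesis using d(4)[of 0] c(2)[of 0] K s by (simp add: eq nth_splice_seq)
  next
    case (Suc r)
    \<comment> \<open>The leftmost conflation composes to zero, and splicing with \<open>i r\<close>
      preserves this. The fact is needed later for maps out of a push-out.\<close>
    have "i r \<cdot> (p s \<cdot> i s) = Zero \<A> B (Cod \<A> (i r))"
      using d[of s] d[of r] c(2)[of s] c(2)[of r] c(3)[of s] K s Suc in_Obj by simp
    then show ?thesis
      using d[of s] d[of r] c(2)[of s] c(2)[of r] c(3)[of s] K s Suc by (simp add: eq nth_splice_seq)
  qed
qed

text \<open>Morphisms compose term by term. With \<open>E1\<close> next to \<open>E\<close> in a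
  zigzag and \<open>E2\<close> a push-out of \<open>E1\<close>, this yields the morphism over
  \<open>g\<close> from \<open>E\<close> to that push-out.\<close>

lemma seq_map_comp_step:
  assumes E: "E \<in> long_conflations \<A> \<C> t A B" and E1: "E1 \<in> long_conflations \<A> \<C> t A B"
    and E2: "E2 \<in> long_conflations \<A> \<C> t A B'" and g: "g \<in> homset \<A> B B'"
    and step: "yoneda_step \<A> t E E1" and map: "seq_map \<A> t g E1 E2"
  shows "seq_map \<A> t g E E2"
proof -
  note d = long_conflationsD[OF E] and d1 = long_conflationsD[OF E1] and d2 = long_conflationsD[OF E2]
  obtain \<phi> where \<phi>: "\<And>j. j<t \<Longrightarrow> \<phi> j \<in> homset \<A> (Dom \<A> (E ! j)) (Dom \<A> (E1 ! j))"
    and a: "E1 ! 0 \<cdot> \<phi> 0 = E ! 0" "\<phi> (t - 1) \<cdot> (E ! t) = E1 ! t"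
      "\<And>j. 0 < j \<Longrightarrow> j < t \<Longrightarrow> E1 ! j \<cdot> \<phi> j = \<phi> (j - 1) \<cdot> (E ! j)"
    using step unfolding yoneda_step_def by blast
  obtain \<psi> where \<psi>: "\<And>j. j<t \<Longrightarrow> \<psi> j \<in> homset \<A> (Dom \<A> (E1 ! j)) (Dom \<A> (E2 ! j))"
    and b: "E2 ! 0 \<cdot> \<psi> 0 = E1 ! 0" "\<psi> (t - 1) \<cdot> (E1 ! t) = E2 ! t \<cdot> g"
      "\<And>j. 0 < j \<Longrightarrow> j < t \<Longrightarrow> E2 ! j \<cdot> \<psi> j = \<psi> (j - 1) \<cdot> (E1 ! j)"
    using map unfolding seq_map_def by blast
  have F: "\<phi> j \<in> Arr \<A>" "Dom \<A> (\<phi> j) = Dom \<A> (E ! j)" "Cod \<A> (\<phi> j) = Dom \<A> (E1 ! j)"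
    "\<psi> j \<in> Arr \<A>" "Dom \<A> (\<psi> j) = Dom \<A> (E1 ! j)" "Cod \<A> (\<psi> j) = Dom \<A> (E2 ! j)" if "j < t" for j
    using \<phi>[OF that] \<psi>[OF that] by (auto simp: homset_def)
  have t: "0 < t" "t - 1 < t" using d(1) by auto
  show ?thesis
    unfolding seq_map_def
  proof (intro exI[of _ "\<lambda>j. \<psi> j \<cdot> \<phi> j"] conjI allI impI)
    show "\<psi> j \<cdot> \<phi> j \<in> homset \<A> (Dom \<A> (E ! j)) (Dom \<A> (E2 ! j))" if "j < t" for j
      using F[OF that] by (simp add: homset_def)
    show "E2 ! 0 \<cdot> (\<psi> 0 \<cdot> \<phi> 0) = E ! 0"
      using comp_reassoc[OF b(1), of "\<phi> 0"] F[OF t(1)] d2(5)[of 0] a(1) by simp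
    have "(\<psi> (t - 1) \<cdot> \<phi> (t - 1)) \<cdot> (E ! t) = \<psi> (t - 1) \<cdot> (\<phi> (t - 1) \<cdot> (E ! t))"
      by (rule comp_assoc) (use F[OF t(2)] d(5)[of t] d(8)[of t] t in simp_all)
    then show "(\<psi> (t - 1) \<cdot> \<phi> (t - 1)) \<cdot> (E ! t) = E2 ! t \<cdot> g"
      using a(2) b(2) by simp
    fix j assume j: "0 < j \<and> j < t"
    then have j': "j < t" "j - 1 < t" "j \<le> t" "0 < j" by auto
    have "E2 ! j \<cdot> (\<psi> j \<cdot> \<phi> j) = (\<psi> (j - 1) \<cdot> (E1 ! j)) \<cdot> \<phi> j"
      by (rule comp_reassoc[OF b(3)]) (use F[OF j'(1)] d2(5)[OF j'(3)] j' in simp_all)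
    also have "\<dots> = \<psi> (j - 1) \<cdot> (E1 ! j \<cdot> \<phi> j)"
      by (rule comp_assoc) (use F[OF j'(1)] F[OF j'(2)] d1(5)[OF j'(3)] d1(8)[OF j'(4,3)] in simp_all)
    also have "\<dots> = \<psi> (j - 1) \<cdot> (\<phi> (j - 1) \<cdot> (E ! j))" using a(3) j by simp
    also have "\<dots> = (\<psi> (j - 1) \<cdot> \<phi> (j - 1)) \<cdot> (E ! j)"
      by (rule comp_assoc[symmetric]) (use F[OF j'(1)] F[OF j'(2)] d(5)[OF j'(3)] d(8)[OF j'(4,3)] in simp_all)
    finally show "E2 ! j \<cdot> (\<psi> j \<cdot> \<phi> j) = (\<psi> (j - 1) \<cdot> \<phi> (j - 1)) \<cdot> (E ! j)" .
  qed
qed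

lemma seq_map_pushout_sequence:
  assumes E: "E \<in> long_conflations \<A> \<C> t A B" and E': "pushout_sequence \<A> t g E E'"
  shows "seq_map \<A> t g E E'"
proof -
  note d = long_conflationsD[OF E]
  obtain u where eq: "\<And>j. j < t - 1 \<Longrightarrow> E' ! j = E ! j" and po: "is_pushout \<A> (E ! t) g u (E' ! t)"
    and h: "E' ! (t - 1) \<in> homset \<A> (Cod \<A> u) (Cod \<A> (E ! (t - 1)))"
      "E' ! (t - 1) \<cdot> u = E ! (t - 1)"
    using E' unfolding pushout_sequence_def by blast
  have u: "u \<in> Arr \<A>" "Dom \<A> u = Dom \<A> (E ! (t - 1))" "Cod \<A> u = Dom \<A> (E' ! (t - 1))"
    "u \<cdot> (E ! t) = E' ! t \<cdot> g"
    using po h d(1) d(8)[of t] by (auto simp: is_pushout_def homset_def)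
  have O: "Dom \<A> (E ! j) \<in> Obj \<A>" if "j \<le> t" for j using d(5)[OF that] Dom_in by simp
  show ?thesis
    unfolding seq_map_def
  \<comment> \<open>Push-out alters only the term of index \<open>t - 1\<close>: the morphism is the
    leg \<open>u\<close> there and an identity elsewhere.\<close>
  proof (intro exI[of _ "\<lambda>j. if j < t - 1 then Idm \<A> (Dom \<A> (E ! j)) else u"] conjI allI impI)
    fix j assume "0 < j \<and> j < t"
    then have j: "j = t - 1 \<or> j < t - 1" "0 < j" "j - 1 < t - 1" "j \<le> t" by auto
    then show "E' ! j \<cdot> (if j < t - 1 then Idm \<A> (Dom \<A> (E ! j)) else u) =
         (if j - 1 < t - 1 then Idm \<A> (Dom \<A> (E ! (j - 1))) else u) \<cdot> (E ! j)"
      using h(2) eq[of j] d(5)[OF j(4)] d(8)[OF j(2,4)] by auto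
  next
    show "(if j < t - 1 then Idm \<A> (Dom \<A> (E ! j)) else u) \<in> homset \<A> (Dom \<A> (E ! j)) (Dom \<A> (E' ! j))"
      if "j < t" for j
    proof (cases "j < t - 1")
      case True
      then show ?thesis using eq[of j] O[of j] that by (simp add: homset_def)
    next
      case False
      then have "j = t - 1" using that by simp
      then show ?thesis using u by (simp add: homset_def)
    qed
    show "E' ! 0 \<cdot> (if 0 < t - 1 then Idm \<A> (Dom \<A> (E ! 0)) else u) = E ! 0"
      using eq[of 0] h(2) d(1,5) by (cases "0 < t - 1") simp_all
    show "(if t - 1 < t - 1 then Idm \<A> (Dom \<A> (E ! (t - 1))) else u) \<cdot> (E ! t) = E' ! t \<cdot> g"
      using u(4) by simp
  qed
qed

text \<open>A morphism over \<open>g\<close> factors through the push-out along \<open>g\<close>,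
  and the second factor fixes both ends. This is how \<open>seq_map\<close> produces equalities in
  Ext.\<close>

lemma yoneda_step_pushout_sequence:
  assumes E: "E \<in> long_conflations \<A> \<C> t A B" and F: "F \<in> long_conflations \<A> \<C> t A B'"
    and g: "g \<in> homset \<A> B B'"
    and po: "pushout_sequence \<A> t g E E'" and map: "seq_map \<A> t g E F"
  shows "yoneda_step \<A> t E' F"
proof -
  note d = long_conflationsD[OF E] and f = long_conflationsD[OF F]
  have t: "0 < t" "t - 1 < t" "t - 1 \<le> t" using d(1) by auto
  obtain u where eq: "\<And>j. j < t - 1 \<Longrightarrow> E' ! j = E ! j" and po: "is_pushout \<A> (E ! t) g u (E' ! t)"
    and h: "E' ! (t - 1) \<in> homset \<A> (Cod \<A> u) (Cod \<A> (E ! (t - 1)))"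
      "E' ! (t - 1) \<cdot> u = E ! (t - 1)" "E' ! (t - 1) \<cdot> (E' ! t) = Zero \<A> (Cod \<A> g) (Cod \<A> (E ! (t - 1)))"
    using po unfolding pushout_sequence_def by blast
  obtain \<phi> where \<phi>: "\<And>j. j<t \<Longrightarrow> \<phi> j \<in> homset \<A> (Dom \<A> (E ! j)) (Dom \<A> (F ! j))"
    and a: "F ! 0 \<cdot> \<phi> 0 = E ! 0" "\<phi> (t - 1) \<cdot> (E ! t) = F ! t \<cdot> g"
      "\<And>j. 0 < j \<Longrightarrow> j < t \<Longrightarrow> F ! j \<cdot> \<phi> j = \<phi> (j - 1) \<cdot> (E ! j)"
    using map unfolding seq_map_def by blast
  have u: "u \<in> Arr \<A>" "Dom \<A> u = Dom \<A> (E ! (t - 1))" "Cod \<A> u = Dom \<A> (E' ! (t - 1))"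
    "E' ! t \<in> Arr \<A>" "Cod \<A> (E' ! t) = Cod \<A> u" "Dom \<A> (E' ! t) = Cod \<A> g" "g \<in> Arr \<A>"
    using po h d(1) d(8)[of t] by (auto simp: is_pushout_def homset_def)
  have p: "E' ! (t - 1) \<in> Arr \<A>" "Dom \<A> (E' ! (t - 1)) = Cod \<A> u" "Cod \<A> (E' ! (t - 1)) = Cod \<A> (E ! (t - 1))"
    using h by (auto simp: homset_def)
  have P: "\<phi> j \<in> Arr \<A>" "Dom \<A> (\<phi> j) = Dom \<A> (E ! j)" "Cod \<A> (\<phi> j) = Dom \<A> (F ! j)" if "j < t" for j
    using \<phi>[OF that] by (auto simp: homset_def)
  have g: "Cod \<A> g = B'" "B' \<in> Obj \<A>" using g f(4) in_Obj by (auto simp: homset_def)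
  have "\<phi> (t - 1) \<in> homset \<A> (Cod \<A> (E ! t)) (Dom \<A> (F ! (t - 1)))"
    "F ! t \<in> homset \<A> (Cod \<A> g) (Dom \<A> (F ! (t - 1)))"
    using P[OF t(2)] d(8)[of t] f(5)[of t] f(7) f(8)[of t] g t by (simp_all add: homset_def)
  \<comment> \<open>The condition on \<open>E' ! t\<close> makes the new morphism the identity at
    the left end.\<close>
  then have "\<exists>!w. w \<in> homset \<A> (Cod \<A> u) (Dom \<A> (F ! (t - 1))) \<and> w \<cdot> u = \<phi> (t - 1) \<and> w \<cdot> (E' ! t) = F ! t"
    using po a(2) unfolding is_pushout_def by blast
  then obtain w where w: "w \<in> Arr \<A>" "Dom \<A> w = Cod \<A> u" "Cod \<A> w = Dom \<A> (F ! (t - 1))"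
    "w \<cdot> u = \<phi> (t - 1)" "w \<cdot> (E' ! t) = F ! t"
    unfolding homset_def by blast
  \<comment> \<open>The remaining condition concerns maps out of the push-out and is checked on both
    legs. On the leg \<open>E' ! t\<close> both sides are zero; this is the side through
    \<open>F\<close>.\<close>
  have FZ: "(F ! (t - 1) \<cdot> w) \<cdot> (E' ! t) = Zero \<A> B' (Cod \<A> (F ! (t - 1)))"
    using comp_assoc[OF u(4) w(1) f(5)[OF t(3)]] w u f(9) by simp
  show ?thesis
    unfolding yoneda_step_def
  proof (intro exI[of _ "\<lambda>j. if j < t - 1 then \<phi> j else w"] conjI allI impI)
    fix j assume "j < t"
    then consider "j < t - 1" | "j = t - 1" by linarith
    then show "(if j < t - 1 then \<phi> j else w) \<in> homset \<A> (Dom \<A> (E' ! j)) (Dom \<A> (F ! j))"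
    proof cases
      case 1
      then show ?thesis using \<phi>[of j] eq[of j] by simp
    next
      case 2
      then show ?thesis using w u by (simp add: homset_def)
    qed
  next
    fix j assume j: "0 < j \<and> j < t"
    then consider "j < t - 1" | "j = t - 1" by linarith
    then show "F ! j \<cdot> (if j < t - 1 then \<phi> j else w) =
        (if j - 1 < t - 1 then \<phi> (j - 1) else w) \<cdot> (E' ! j)"
    proof cases
      case 1
      then have "j - 1 < t - 1" by simp
      then show ?thesis using 1 a(3)[of j] eq[of j] j by simp
    next
      case 2
      have j': "j - 1 < t" "j \<le> t" "0 < j" using j by auto
      have "F ! j \<cdot> w = \<phi> (j - 1) \<cdot> (E' ! j)"
      proof (rule is_pushout_unique[OF po])
        have "(F ! j \<cdot> w) \<cdot> u = F ! j \<cdot> \<phi> j"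
          using comp_assoc[OF u(1) w(1) f(5)[OF j'(2)]] w 2 by simp
        also have "\<dots> = \<phi> (j - 1) \<cdot> (E' ! j \<cdot> u)" using a(3)[of j] h(2) j 2 by simp
        also have "\<dots> = (\<phi> (j - 1) \<cdot> (E' ! j)) \<cdot> u"
          by (rule comp_assoc[symmetric]) (use u p P[OF j'(1)] d(8)[OF j'(3,2)] 2 in simp_all)
        finally show "(F ! j \<cdot> w) \<cdot> u = (\<phi> (j - 1) \<cdot> (E' ! j)) \<cdot> u" .
        have "(\<phi> (j - 1) \<cdot> (E' ! j)) \<cdot> (E' ! t) = \<phi> (j - 1) \<cdot> (E' ! j \<cdot> (E' ! t))"
          by (rule comp_assoc) (use u p P[OF j'(1)] d(8)[OF j'(3,2)] 2 in simp_all)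
        also have "\<dots> = Zero \<A> B' (Dom \<A> (F ! (j - 1)))"
          using h(3) g P[OF j'(1)] d(8)[OF j'(3,2)] 2 by simp
        also have "\<dots> = (F ! j \<cdot> w) \<cdot> (E' ! t)" using FZ f(8)[OF j'(3,2)] 2 by simp
        finally show "(F ! j \<cdot> w) \<cdot> (E' ! t) = (\<phi> (j - 1) \<cdot> (E' ! j)) \<cdot> (E' ! t)" ..
      qed (use w u p P[OF j'(1)] f(5)[OF j'(2)] f(8)[OF j'(3,2)] d(8)[OF j'(3,2)] 2 in simp_all)
      moreover have "j - 1 < t - 1" using j by linarith
      ultimately show ?thesis using 2 by simp
    qed
  next
    show "(if t - 1 < t - 1 then \<phi> (t - 1) else w) \<cdot> (E' ! t) = F ! t" using w by simp
    show "F ! 0 \<cdot> (if 0 < t - 1 then \<phi> 0 else w) = E' ! 0"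
    proof (cases "0 < t - 1")
      case True
      then show ?thesis using a(1) eq[of 0] by simp
    next
      case False
      \<comment> \<open>Here the push-out is the term next to \<open>A\<close>, so \<open>w\<close>
        itself must satisfy the condition at the right end.\<close>
      then have t1: "t = 1" using t by simp
      have "F ! 0 \<cdot> w = E' ! 0"
      proof (rule is_pushout_unique[OF po])
        show "(F ! 0 \<cdot> w) \<cdot> u = (E' ! 0) \<cdot> u"
          using comp_assoc[OF u(1) w(1) f(5)[of 0]] w h(2) a(1) t1 by simp
        show "(F ! 0 \<cdot> w) \<cdot> (E' ! t) = (E' ! 0) \<cdot> (E' ! t)"
          using FZ h(3) g f(6) d(6) t1 by simp
      qed (use w p f(5)[of 0] f(6) d(6) t1 in simp_all)
      then show ?thesis using t1 by simp
    qed
  qed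
qed

text \<open>Only the leftmost conflation changes. Its push-out is again a conflation with the same
  end \<open>K s\<close>, so it can be spliced with the others.\<close>

lemma pushout_sequence_long_conflations:
  assumes E: "E \<in> long_conflations \<A> \<C> t A B" and g: "g \<in> homset \<A> B B'" and B': "B' \<in> \<C>"
    and po: "pushout_sequence \<A> t g E E'"
  shows "E' \<in> long_conflations \<A> \<C> t A B'"
proof -
  obtain K i p where t: "1 \<le> t" and K: "K 0 = A" "K t = B" and eqE: "E = splice_seq \<A> t i p"
    and c: "\<And>j. j < t \<Longrightarrow> conflation \<A> \<C> (i j) (p j)" "\<And>j. j < t \<Longrightarrow> Dom \<A> (i j) = K (j + 1)"
      "\<And>j. j < t \<Longrightarrow> Cod \<A> (p j) = K j"
    using E unfolding long_conflations_iff by blast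
  note d = conflationD[OF c(1)]
  define s where "s = t - 1"
  have s: "t = Suc s" using t by (simp add: s_def)
  have E_t: "E ! t = i s" using s by (simp add: eqE nth_splice_seq)
  obtain u where len: "length E' = t + 1" and eq: "\<And>j. j < s \<Longrightarrow> E' ! j = E ! j"
    and po: "is_pushout \<A> (i s) g u (E' ! t)"
    and h: "E' ! s \<in> homset \<A> (Cod \<A> u) (Cod \<A> (E ! s))"
      "E' ! s \<cdot> u = E ! s" "E' ! s \<cdot> (E' ! t) = Zero \<A> (Cod \<A> g) (Cod \<A> (E ! s))"
    using po E_t unfolding pushout_sequence_def s_def[symmetric] by auto
  have ss: "s < t" using s by simp
  have G: "Cod \<A> g = B'" using g by (simp add: homset_def)
  obtain p' where p': "p' \<in> homset \<A> (Cod \<A> u) (Cod \<A> (p s))" "p' \<cdot> u = p s"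
    "p' \<cdot> (E' ! t) = Zero \<A> (Cod \<A> g) (Cod \<A> (p s))"
    using ex_pushout_cokernel[OF po d(6)[OF ss]] by blast
  have c': "conflation \<A> \<C> (E' ! t) p'"
    using pushout_conflation[OF po c(1)[OF ss] _ p'] B' G by simp
  have u: "u \<in> Arr \<A>" "Dom \<A> u = Dom \<A> (p s)" "Cod \<A> (E' ! t) = Cod \<A> u" "Dom \<A> (E' ! t) = B'"
    "E' ! t \<in> Arr \<A>"
    using po d(3)[OF ss] G by (auto simp: is_pushout_def)
  have P: "p' \<in> Arr \<A>" "Dom \<A> p' = Cod \<A> u" "Cod \<A> p' = K s"
    using p' c(3)[OF ss] by (auto simp: homset_def)
  have H: "E' ! s \<in> Arr \<A>" "Dom \<A> (E' ! s) = Cod \<A> u" "Cod \<A> (E' ! s) = Cod \<A> (E ! s)"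
    using h(1) by (auto simp: homset_def)
  \<comment> \<open>\<open>pushout_sequence\<close> determines \<open>E' ! s\<close> only by its
    values on the two legs. The spliced map has the same values, hence is equal to it; for
    \<open>s = 0\<close> there is nothing to splice with.\<close>
  have E's: "E' ! s = (if s = 0 then p' else i (s - 1) \<cdot> p')"
  proof (rule is_pushout_unique[OF po])
    show "Cod \<A> (E' ! s) = Cod \<A> (if s = 0 then p' else i (s - 1) \<cdot> p')"
      using H P c(2)[of "s - 1"] c(3)[of s] d(1)[of "s - 1"] d(2)[of s] s
      by (cases s) (simp_all add: eqE nth_splice_seq)
    show "E' ! s \<cdot> u = (if s = 0 then p' else i (s - 1) \<cdot> p') \<cdot> u"
      using h(2) p'(2) P u c(2)[of "s - 1"] d(1)[of "s - 1"] s
      by (cases s) (simp_all add: eqE nth_splice_seq)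
    show "E' ! s \<cdot> (E' ! t) = (if s = 0 then p' else i (s - 1) \<cdot> p') \<cdot> (E' ! t)"
      using h(3) p'(3) P u c(2)[of "s - 1"] c(3)[of s] d(1)[of "s - 1"] d(2)[of s] s G in_Obj[OF B']
      by (cases s) (simp_all add: eqE nth_splice_seq)
  qed (use H P c(2)[of "s - 1"] d(1)[of "s - 1"] s in \<open>cases s; simp\<close>)+
  have "E' = splice_seq \<A> t (i(s := E' ! t)) (p(s := p'))"
  proof (rule nth_equalityI)
    fix j assume "j < length E'"
    then consider "j < s" | "j = s" | "j = t" using len s by force
    then show "E' ! j = splice_seq \<A> t (i(s := E' ! t)) (p(s := p')) ! j"
    proof cases
      case 1
      then have "j - 1 \<noteq> s" by simp
      then show ?thesis using 1 eq[of j] s by (simp add: eqE nth_splice_seq)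
    next
      case 2
      then show ?thesis using E's s by (cases s) (simp_all add: nth_splice_seq)
    next
      case 3
      then show ?thesis using s by (simp add: nth_splice_seq)
    qed
  qed (use len in simp)
  moreover have "conflation \<A> \<C> ((i(s := E' ! t)) j) ((p(s := p')) j) \<and>
      Dom \<A> ((i(s := E' ! t)) j) = (K(t := B')) (j + 1) \<and> Cod \<A> ((p(s := p')) j) = (K(t := B')) j"
    if "j < t" for j
    using that c[of j] c' u P s by auto
  moreover have "(K(t := B')) 0 = A" "(K(t := B')) t = B'" using t K by simp_all
  ultimately show ?thesis
    unfolding long_conflations_iff using t by blast
qed

lemma ex_pushout_sequence:
  assumes E: "E \<in> long_conflations \<A> \<C> t A B" and g: "g \<in> homset \<A> B B'"
  obtains E' where "pushout_sequence \<A> t g E E'"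
proof -
  obtain K i p where t: "1 \<le> t" and K: "K 0 = A" "K t = B" and eqE: "E = splice_seq \<A> t i p"
    and c: "\<And>j. j < t \<Longrightarrow> conflation \<A> \<C> (i j) (p j)" "\<And>j. j < t \<Longrightarrow> Dom \<A> (i j) = K (j + 1)"
      "\<And>j. j < t \<Longrightarrow> Cod \<A> (p j) = K j"
    using E unfolding long_conflations_iff by blast
  note d = conflationD[OF c(1)]
  define s where "s = t - 1"
  have s: "t = Suc s" "s < t" using t by (auto simp: s_def)
  have g': "g \<in> Arr \<A>" "Dom \<A> g = B" using g by (auto simp: homset_def)
  obtain u b' where po: "is_pushout \<A> (i s) g u b'"
    by (rule ex_pushout[of "i s" g]) (use d(1)[OF s(2)] c(2)[OF s(2)] K s g' in simp_all)
  obtain p' where p': "p' \<in> homset \<A> (Cod \<A> u) (Cod \<A> (p s))" "p' \<cdot> u = p s"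
    "p' \<cdot> b' = Zero \<A> (Cod \<A> g) (Cod \<A> (p s))"
    using ex_pushout_cokernel[OF po d(6)[OF s(2)]] by blast
  have P: "p' \<in> Arr \<A>" "Dom \<A> p' = Cod \<A> u" "Cod \<A> p' = K s"
    using p' c(3)[OF s(2)] by (auto simp: homset_def)
  have u: "u \<in> Arr \<A>" "b' \<in> Arr \<A>" "Cod \<A> b' = Cod \<A> u" "Dom \<A> b' = Cod \<A> g"
    using po by (auto simp: is_pushout_def)
  have "Cod \<A> g \<in> Obj \<A>" using g' Cod_in by simp
  then have *: "splice_seq \<A> t (i(s := b')) (p(s := p')) ! s \<in> homset \<A> (Cod \<A> u) (Cod \<A> (E ! s))"
    "splice_seq \<A> t (i(s := b')) (p(s := p')) ! s \<cdot> u = E ! s"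
    "splice_seq \<A> t (i(s := b')) (p(s := p')) ! s \<cdot> b' = Zero \<A> (Cod \<A> g) (Cod \<A> (E ! s))"
    using p' P u s c(2)[of "s - 1"] c(3)[of s] d(1)[of "s - 1"] d(2)[of s]
    by (cases s; simp add: eqE nth_splice_seq homset_def)+
  have "pushout_sequence \<A> t g E (splice_seq \<A> t (i(s := b')) (p(s := p')))"
    unfolding pushout_sequence_def s_def[symmetric]
    using s po * by (auto simp: eqE nth_splice_seq intro!: exI[of _ u])
  then show ?thesis by (rule that)
qed

end

section \<open>Equivalence classes\<close>

lemma ext_rel_refl: "E \<in> long_conflations \<A> \<C> t A B \<Longrightarrow> (E, E) \<in> ext_rel \<A> \<C> t A B"
  by (simp add: ext_rel_def)

lemma ext_rel_sym: "(E, F) \<in> ext_rel \<A> \<C> t A B \<Longrightarrow> (F, E) \<in> ext_rel \<A> \<C> t A B"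
  by (auto simp: ext_rel_def intro: equivclp_sym)

lemma ext_rel_trans:
  "(E, F) \<in> ext_rel \<A> \<C> t A B \<Longrightarrow> (F, G) \<in> ext_rel \<A> \<C> t A B \<Longrightarrow> (E, G) \<in> ext_rel \<A> \<C> t A B"
  by (auto simp: ext_rel_def intro: equivclp_trans)

lemma ext_rel_step:
  "E \<in> long_conflations \<A> \<C> t A B \<Longrightarrow> F \<in> long_conflations \<A> \<C> t A B \<Longrightarrow> yoneda_step \<A> t E F \<Longrightarrow>
    (E, F) \<in> ext_rel \<A> \<C> t A B"
  by (simp add: ext_rel_def r_into_equivclp)

text \<open>Induction along a zigzag that starts at \<open>E\<close>, with one case for each
  direction in which the next link may point.\<close>

lemma ext_rel_induct [consumes 1, case_names refl step step_rev]:
  assumes "(E, F) \<in> ext_rel \<A> \<C> t A B"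
    and "P E"
    and step: "\<And>F G. F \<in> long_conflations \<A> \<C> t A B \<Longrightarrow> G \<in> long_conflations \<A> \<C> t A B \<Longrightarrow>
      yoneda_step \<A> t F G \<Longrightarrow> P F \<Longrightarrow> P G"
    and step_rev: "\<And>F G. F \<in> long_conflations \<A> \<C> t A B \<Longrightarrow> G \<in> long_conflations \<A> \<C> t A B \<Longrightarrow>
      yoneda_step \<A> t G F \<Longrightarrow> P F \<Longrightarrow> P G"
  shows "P F"
proof -
  let ?R = "\<lambda>F F'. F \<in> long_conflations \<A> \<C> t A B \<and> F' \<in> long_conflations \<A> \<C> t A B \<and> yoneda_step \<A> t F F'"
  have "equivclp ?R E F" using assms(1) by (simp add: ext_rel_def)
  then show ?thesis
    by (induction rule: equivclp_induct) (use assms(2) step step_rev in blast)+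
qed

section \<open>Push-out of Ext classes and the covering construction\<close>

context extension_closed_subcategory
begin

lemma ext_rel_pushout_sequence:
  assumes EF: "(E, F) \<in> ext_rel \<A> \<C> t A B" and g: "g \<in> homset \<A> B B'" and B': "B' \<in> \<C>"
    and G: "G \<in> long_conflations \<A> \<C> t A B'" and map: "seq_map \<A> t g E G"
    and po: "pushout_sequence \<A> t g F F'"
  shows "(F', G) \<in> ext_rel \<A> \<C> t A B'"
proof -
  note LC = pushout_sequence_long_conflations[OF _ g B']
  have E: "E \<in> long_conflations \<A> \<C> t A B" using EF by (simp add: ext_rel_def)
  \<comment> \<open>A link followed by the canonical morphism to \<open>F2'\<close> is a morphism
    over \<open>g\<close>, so it factors through \<open>F1'\<close>. With both sequences equal this
    also relates any two push-outs of one sequence.\<close>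
  have rel: "(F1', F2') \<in> ext_rel \<A> \<C> t A B'"
    if "F1 \<in> long_conflations \<A> \<C> t A B" "F2 \<in> long_conflations \<A> \<C> t A B" "yoneda_step \<A> t F1 F2"
      "pushout_sequence \<A> t g F1 F1'" "pushout_sequence \<A> t g F2 F2'" for F1 F2 F1' F2'
  proof -
    have "seq_map \<A> t g F1 F2'"
      by (rule seq_map_comp_step[OF that(1,2) LC[OF that(2,5)] g that(3)
            seq_map_pushout_sequence[OF that(2,5)]])
    then have "yoneda_step \<A> t F1' F2'"
      by (rule yoneda_step_pushout_sequence[OF that(1) LC[OF that(2,5)] g that(4)])
    then show ?thesis by (rule ext_rel_step[OF LC[OF that(1,4)] LC[OF that(2,5)]])
  qed
  \<comment> \<open>The invariant ranges over all push-outs of \<open>F\<close>, since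
    \<open>ext_push\<close> does not select one.\<close>
  have "\<forall>F'. pushout_sequence \<A> t g F F' \<longrightarrow> (F', G) \<in> ext_rel \<A> \<C> t A B'"
    using EF
  proof (induction rule: ext_rel_induct)
    case refl
    show ?case
    proof (intro allI impI)
      fix F' assume "pushout_sequence \<A> t g E F'"
      then show "(F', G) \<in> ext_rel \<A> \<C> t A B'"
        using ext_rel_step LC[OF E] G yoneda_step_pushout_sequence[OF E G g _ map] by metis
    qed
  next
    case (step F1 F2)
    obtain F1' where F1': "pushout_sequence \<A> t g F1 F1'"
      using ex_pushout_sequence[OF step.hyps(1) g] by blast
    show ?case
      using ext_rel_trans[OF ext_rel_sym[OF rel[OF step.hyps F1']] step.IH[rule_format, OF F1']]
      by blast
  next
    case (step_rev F1 F2)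
    obtain F1' where F1': "pushout_sequence \<A> t g F1 F1'"
      using ex_pushout_sequence[OF step_rev.hyps(1) g] by blast
    show ?case
      using ext_rel_trans[OF rel[OF step_rev.hyps(2,1,3) _ F1'] step_rev.IH[rule_format, OF F1']]
      by blast
  qed
  then show ?thesis using po by blast
qed

text \<open>Every push-out of every representative lies in the class of \<open>G\<close>, and at
  least one push-out exists, so the saturated set in \<open>ext_push\<close> is exactly that
  class.\<close>

lemma ext_push_eq:
  assumes E: "E \<in> long_conflations \<A> \<C> t A B" and g: "g \<in> homset \<A> B B'" and B': "B' \<in> \<C>"
    and G: "G \<in> long_conflations \<A> \<C> t A B'" and map: "seq_map \<A> t g E G"
  shows "ext_push \<A> \<C> t A g (ext_class \<A> \<C> t A B E) = ext_class \<A> \<C> t A B' G"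
proof -
  have "Cod \<A> g = B'" using g by (simp add: homset_def)
  moreover obtain E' where E': "pushout_sequence \<A> t g E E'" using ex_pushout_sequence[OF E g] by blast
  moreover have "(F', G) \<in> ext_rel \<A> \<C> t A B'"
    if "(E, F) \<in> ext_rel \<A> \<C> t A B" "pushout_sequence \<A> t g F F'" for F F'
    using ext_rel_pushout_sequence[OF that(1) g B' G map that(2)] .
  ultimately show ?thesis
    unfolding ext_push_def ext_class_def
  proof -
    assume G': "Cod \<A> g = B'" and E': "pushout_sequence \<A> t g E E'"
      and rel: "\<And>F F'. (E, F) \<in> ext_rel \<A> \<C> t A B \<Longrightarrow> pushout_sequence \<A> t g F F' \<Longrightarrow>
        (F', G) \<in> ext_rel \<A> \<C> t A B'"
    show "ext_rel \<A> \<C> t A (Cod \<A> g) `` {E'. \<exists>F\<in>ext_rel \<A> \<C> t A B `` {E}. pushout_sequence \<A> t g F E'} =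
        ext_rel \<A> \<C> t A B' `` {G}" (is "?L = ?R")
    proof
      show "?L \<subseteq> ?R"
        unfolding G' using ext_rel_trans[OF ext_rel_sym[OF rel]] by blast
      show "?R \<subseteq> ?L"
        unfolding G' using ext_rel_trans[OF rel[OF ext_rel_refl[OF E] E']] E' ext_rel_refl[OF E] by blast
    qed
  qed
qed

text \<open>One stage of the covering, for an arbitrary class \<open>\<P>\<close> with enough
  deflations. The map \<open>g'\<close> on kernels becomes the \<open>g\<close> of the next
  stage.\<close>

lemma ex_covering_conflation:
  assumes enough: "\<And>X. X \<in> \<C> \<Longrightarrow> \<exists>P p. P \<in> \<P> \<and> p \<in> homset \<A> P X \<and> deflation \<A> \<C> p"
    and c: "conflation \<A> \<C> i p"
    and g: "g \<in> Arr \<A>" "Cod \<A> g = Cod \<A> p" "Dom \<A> g \<in> \<C>"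
  obtains i' p' \<phi> g' where "conflation \<A> \<C> i' p'" "Dom \<A> p' \<in> \<P>" "Cod \<A> p' = Dom \<A> g"
    "\<phi> \<in> homset \<A> (Dom \<A> p') (Dom \<A> p)" "g' \<in> homset \<A> (Dom \<A> i') (Dom \<A> i)"
    "p \<cdot> \<phi> = g \<cdot> p'" "\<phi> \<cdot> i' = i \<cdot> g'"
proof -
  note d = conflationD[OF c]
  obtain v i1 q where pb: "is_pullback \<A> p g v q" and c1: "conflation \<A> \<C> i1 q"
    and i1: "i1 \<in> homset \<A> (Dom \<A> i) (Dom \<A> v)" "v \<cdot> i1 = i"
    by (rule ex_pullback_conflation[OF c g])
  note d1 = conflationD[OF c1]
  have v: "v \<in> Arr \<A>" "Cod \<A> v = Dom \<A> p" "Dom \<A> v = Dom \<A> q" "Cod \<A> q = Dom \<A> g" "p \<cdot> v = g \<cdot> q"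
    using pb by (auto simp: is_pullback_def)
  obtain P r where P: "P \<in> \<P>" "r \<in> homset \<A> P (Dom \<A> q)" "deflation \<A> \<C> r"
    using enough[OF d1(9)] by blast
  obtain k where k: "conflation \<A> \<C> k r" using P(3) by (auto simp: deflation_def)
  have r: "r \<in> Arr \<A>" "Dom \<A> r = P" "Cod \<A> r = Dom \<A> q" using P(2) by (auto simp: homset_def)
  \<comment> \<open>The domain of \<open>i1\<close> is that of \<open>i\<close>, as pull-back leaves
    the kernel unchanged, so \<open>h\<close> serves as \<open>g'\<close>.\<close>
  obtain i' h where i': "conflation \<A> \<C> i' (q \<cdot> r)" "h \<in> homset \<A> (Dom \<A> i') (Dom \<A> i1)" "r \<cdot> i' = i1 \<cdot> h"
    by (rule conflation_comp[OF c1 k r(3)])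
  note d' = conflationD[OF i'(1)]
  have h: "h \<in> Arr \<A>" "Dom \<A> h = Dom \<A> i'" "Cod \<A> h = Dom \<A> i1" "Dom \<A> i1 = Dom \<A> i" "Cod \<A> i1 = Dom \<A> v"
    using i'(2) i1 by (auto simp: homset_def)
  show ?thesis
  proof (rule that[OF i'(1)])
    show "Dom \<A> (q \<cdot> r) \<in> \<P>" "Cod \<A> (q \<cdot> r) = Dom \<A> g"
      using r d1 v P by simp_all
    show "v \<cdot> r \<in> homset \<A> (Dom \<A> (q \<cdot> r)) (Dom \<A> p)" "h \<in> homset \<A> (Dom \<A> i') (Dom \<A> i)"
      using r d1 v h by (simp_all add: homset_def)
    show "p \<cdot> (v \<cdot> r) = g \<cdot> (q \<cdot> r)"
      using comp_reassoc[OF v(5), of r] r v d d1 g by simp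
    have "(v \<cdot> r) \<cdot> i' = v \<cdot> (i1 \<cdot> h)"
      using comp_assoc[OF d'(1) r(1) v(1)] d' d1 r v i'(3) by simp
    also have "\<dots> = i \<cdot> h" using comp_reassoc[OF i1(2), of h] h d1 v by simp
    finally show "(v \<cdot> r) \<cdot> i' = i \<cdot> h" .
  qed
qed

text \<open>Comparing \<open>E\<close> with a resolution of \<open>A\<close> needs no lifting property: each term is chosen to
  cover a pull-back of the corresponding conflation of \<open>E\<close>, so that the morphism onto \<open>E\<close> comes
  for free.\<close>

lemma ex_cover:
  assumes enough: "\<And>X. X \<in> \<C> \<Longrightarrow> \<exists>P p. P \<in> \<P> \<and> p \<in> homset \<A> P X \<and> deflation \<A> \<C> p"
    and E: "E \<in> long_conflations \<A> \<C> t A B"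
  obtains B' \<delta> g where "\<delta> \<in> long_conflations \<A> \<C> t A B'" "\<And>j. j < t \<Longrightarrow> Dom \<A> (\<delta> ! j) \<in> \<P>"
    "g \<in> homset \<A> B' B" "seq_map \<A> t g \<delta> E"
proof -
  obtain K i p where t: "1 \<le> t" and K: "K 0 = A" "K t = B" and eqE: "E = splice_seq \<A> t i p"
    and c: "\<And>j. j < t \<Longrightarrow> conflation \<A> \<C> (i j) (p j)" "\<And>j. j < t \<Longrightarrow> Dom \<A> (i j) = K (j + 1)"
      "\<And>j. j < t \<Longrightarrow> Cod \<A> (p j) = K j"
    using E unfolding long_conflations_iff by blast
  note d = conflationD[OF c(1)]
  have A: "A \<in> \<C>" "A \<in> Obj \<A>" using long_conflationsD(3)[OF E] in_Obj by auto
  \<comment> \<open>Stage \<open>j\<close> pulls back along \<open>g j\<close> and outputs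
    \<open>g (Suc j)\<close>. Thus \<open>t\<close> stages use \<open>t + 1\<close> maps
    \<open>g\<close>, from the identity of \<open>A\<close> to the wanted
    \<open>g t\<close>.\<close>
  define good where "good i' p' \<phi> g j \<longleftrightarrow> conflation \<A> \<C> (i' j) (p' j) \<and> Dom \<A> (p' j) \<in> \<P> \<and>
      Cod \<A> (p' j) = Dom \<A> (g j) \<and> \<phi> j \<in> homset \<A> (Dom \<A> (p' j)) (Dom \<A> (p j)) \<and>
      g (Suc j) \<in> homset \<A> (Dom \<A> (i' j)) (K (Suc j)) \<and>
      p j \<cdot> \<phi> j = g j \<cdot> p' j \<and> \<phi> j \<cdot> i' j = i j \<cdot> g (Suc j)"
    for i' p' \<phi> g and j :: nat
  have "\<exists>i' p' \<phi> g. g 0 = Idm \<A> A \<and> (\<forall>j<m. good i' p' \<phi> g j)" if "m \<le> t" for m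
    using that
  proof (induction m)
    case 0
    then show ?case by auto
  next
    case (Suc m)
    then obtain i' p' \<phi> g where g0: "g 0 = Idm \<A> A" and IH: "\<And>j. j < m \<Longrightarrow> good i' p' \<phi> g j" by auto
    have m: "m < t" using Suc.prems by simp
    have g: "g m \<in> Arr \<A>" "Cod \<A> (g m) = Cod \<A> (p m)" "Dom \<A> (g m) \<in> \<C>"
    proof -
      have "g m \<in> Arr \<A> \<and> Cod \<A> (g m) = Cod \<A> (p m) \<and> Dom \<A> (g m) \<in> \<C>"
      proof (cases m)
        case 0
        then show ?thesis using g0 A K c(3)[OF m] by simp
      next
        case (Suc r)
        then show ?thesis
          using IH[of r] c(3)[OF m] by (auto simp: good_def homset_def conflation_def)
      qed
      then show "g m \<in> Arr \<A>" "Cod \<A> (g m) = Cod \<A> (p m)" "Dom \<A> (g m) \<in> \<C>" by auto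
    qed
    obtain i1 p1 \<phi>1 g1 where *: "conflation \<A> \<C> i1 p1" "Dom \<A> p1 \<in> \<P>" "Cod \<A> p1 = Dom \<A> (g m)"
      "\<phi>1 \<in> homset \<A> (Dom \<A> p1) (Dom \<A> (p m))" "g1 \<in> homset \<A> (Dom \<A> i1) (Dom \<A> (i m))"
      "p m \<cdot> \<phi>1 = g m \<cdot> p1" "\<phi>1 \<cdot> i1 = i m \<cdot> g1"
      by (rule ex_covering_conflation[OF enough c(1)[OF m] g])
    \<comment> \<open>Earlier stages survive the updates because stage \<open>j\<close> looks at
      \<open>g\<close> only in \<open>j\<close> and \<open>Suc j\<close>, both at most
      \<open>m\<close> when \<open>j < m\<close>.\<close>
    have "good (i'(m := i1)) (p'(m := p1)) (\<phi>(m := \<phi>1)) (g(Suc m := g1)) j" if "j < Suc m" for j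
    proof (cases "j = m")
      case True
      then show ?thesis using * c(2)[OF m] by (simp add: good_def)
    next
      case False
      then show ?thesis using IH[of j] that by (simp add: good_def)
    qed
    moreover have "(g(Suc m := g1)) 0 = Idm \<A> A" using g0 by simp
    ultimately show ?case by blast
  qed
  then obtain i' p' \<phi> g where g0: "g 0 = Idm \<A> A" and good: "\<And>j. j < t \<Longrightarrow> good i' p' \<phi> g j"
    by blast
  note G = good[unfolded good_def]
  define \<delta> where "\<delta> = splice_seq \<A> t i' p'"
  have gArr: "g j \<in> Arr \<A>" "Cod \<A> (g j) = K j" if "j \<le> t" for j
    using that g0 A K G[of "j - 1"] by (cases j; auto simp: homset_def)+
  have c': "conflation \<A> \<C> (i' j) (p' j)" "Dom \<A> (i' j) = Dom \<A> (g (j + 1))" "Cod \<A> (p' j) = Dom \<A> (g j)"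
    if "j < t" for j
    using G[OF that] by (auto simp: homset_def)
  note d' = conflationD[OF c'(1)]
  have \<phi>: "\<phi> j \<in> Arr \<A>" "Dom \<A> (\<phi> j) = Dom \<A> (p' j)" "Cod \<A> (\<phi> j) = Dom \<A> (p j)"
    "p j \<cdot> \<phi> j = g j \<cdot> p' j" "\<phi> j \<cdot> i' j = i j \<cdot> g (Suc j)" if "j < t" for j
    using G[OF that] by (auto simp: homset_def)
  have DomE: "Dom \<A> (E ! j) = Dom \<A> (p j)" and Dom\<delta>: "Dom \<A> (\<delta> ! j) = Dom \<A> (p' j)" if "j < t" for j
    using that d(1,2,3) c(2,3) d'(1,2,3) c'(2,3)
    by (cases j; auto simp: eqE \<delta>_def nth_splice_seq)+
  show ?thesis
  proof (rule that)
    \<comment> \<open>The domains of the maps \<open>g j\<close> are the objects at which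
      \<open>\<delta>\<close> is spliced.\<close>
    show "\<delta> \<in> long_conflations \<A> \<C> t A (Dom \<A> (g t))"
      unfolding long_conflations_iff
      using t c' g0 A by (intro conjI exI[of _ "\<lambda>j. Dom \<A> (g j)"] exI[of _ i'] exI[of _ p']) (auto simp: \<delta>_def)
    show "Dom \<A> (\<delta> ! j) \<in> \<P>" if "j < t" for j
      using G[OF that] Dom\<delta>[OF that] by simp
    show "g t \<in> homset \<A> (Dom \<A> (g t)) B"
      using gArr[of t] K by (simp add: homset_def)
    show "seq_map \<A> t (g t) \<delta> E"
      unfolding seq_map_def
    proof (intro exI[of _ \<phi>] conjI allI impI)
      show "\<phi> j \<in> homset \<A> (Dom \<A> (\<delta> ! j)) (Dom \<A> (E ! j))" if "j < t" for j
        using \<phi>[OF that] DomE[OF that] Dom\<delta>[OF that] by (simp add: homset_def)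
      show "E ! 0 \<cdot> \<phi> 0 = \<delta> ! 0"
        using t \<phi>(4)[of 0] g0 d'(2)[of 0] c'(3)[of 0] A by (simp add: eqE \<delta>_def nth_splice_seq)
      show "\<phi> (t - 1) \<cdot> (\<delta> ! t) = E ! t \<cdot> g t"
        using t \<phi>(5)[of "t - 1"] by (simp add: eqE \<delta>_def nth_splice_seq)
      fix j assume "0 < j \<and> j < t"
      then obtain r where j: "j = Suc r" "j < t" "r < t" by (cases j) auto
      have "(i r \<cdot> p j) \<cdot> \<phi> j = i r \<cdot> (g j \<cdot> p' j)"
        using comp_assoc[of "\<phi> j" "p j" "i r"] \<phi>[OF j(2)] d[OF j(2)] d[OF j(3)] c(2)[OF j(3)] c(3)[OF j(2)] j(1)
        by simp
      also have "\<dots> = (\<phi> r \<cdot> i' r) \<cdot> p' j"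
        using comp_assoc[of "p' j" "g j" "i r"] \<phi>(5)[OF j(3)] gArr[of j] d[OF j(3)] d'[OF j(2)] c'(3)[OF j(2)]
          c(2)[OF j(3)] j by simp
      also have "\<dots> = \<phi> r \<cdot> (i' r \<cdot> p' j)"
        by (rule comp_assoc) (use \<phi>[OF j(3)] d'[OF j(2)] d'[OF j(3)] c'(2)[OF j(3)] c'(3)[OF j(2)] j in simp_all)
      finally show "E ! j \<cdot> \<phi> j = \<phi> (j - 1) \<cdot> (\<delta> ! j)"
        using j by (simp add: eqE \<delta>_def nth_splice_seq)
    qed
  qed
qed

text \<open>Part (2) for an arbitrary class \<open>\<P>\<close>. In the opposite category the same
  statement treats a class with enough inflations.\<close>

lemma ext_class_eq_ext_push:
  assumes enough: "\<And>X. X \<in> \<C> \<Longrightarrow> \<exists>P p. P \<in> \<P> \<and> p \<in> homset \<A> P X \<and> deflation \<A> \<C> p"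
    and E: "E \<in> long_conflations \<A> \<C> t A B"
  obtains B' \<delta> g where "\<delta> \<in> long_conflations \<A> \<C> t A B'" "\<And>j. j < t \<Longrightarrow> Dom \<A> (\<delta> ! j) \<in> \<P>"
    "g \<in> homset \<A> B' B" "ext_class \<A> \<C> t A B E = ext_push \<A> \<C> t A g (ext_class \<A> \<C> t A B' \<delta>)"
  using ex_cover[OF enough E] ext_push_eq[OF _ _ long_conflationsD(4)[OF E] E] by metis

end

section \<open>Reversal of sequences\<close>

lemma long_conflations_rev:
  assumes "E \<in> long_conflations \<A> \<C> t A B"
  shows "rev E \<in> long_conflations (op_cat \<A>) \<C> t B A"
proof -
  obtain K i p where t: "1 \<le> t" and len: "length E = t + 1" and K: "K 0 = A" "K t = B"
    and c: "\<And>j. j < t \<Longrightarrow> conflation \<A> \<C> (i j) (p j)" "\<And>j. j < t \<Longrightarrow> Dom \<A> (i j) = K (j + 1)"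
      "\<And>j. j < t \<Longrightarrow> Cod \<A> (p j) = K j"
    and eq: "E ! 0 = p 0" "E ! t = i (t - 1)" "\<And>j. 0 < j \<Longrightarrow> j < t \<Longrightarrow> E ! j = i (j - 1) \<cdot>\<^bsub>\<A>\<^esub> p j"
    using assms unfolding long_conflations_def by blast
  show ?thesis
    unfolding long_conflations_def mem_Collect_eq
  \<comment> \<open>There are \<open>t + 1\<close> splicing objects but only \<open>t\<close>
    conflations, hence the two different reflections of the index.\<close>
  proof (intro conjI; (rule exI[of _ "\<lambda>j. K (t - j)"], rule exI[of _ "\<lambda>j. p (t - 1 - j)"],
      rule exI[of _ "\<lambda>j. i (t - 1 - j)"], intro conjI allI impI)?)
    fix j assume j: "j < t"
    then have j': "t - 1 - j < t" "t - 1 - j + 1 = t - j" "t - (j + 1) = t - 1 - j" by auto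
    show "conflation (op_cat \<A>) \<C> (p (t - 1 - j)) (i (t - 1 - j))"
      using c(1)[OF j'(1)] by (simp add: conflation_op_cat)
    show "Dom (op_cat \<A>) (p (t - 1 - j)) = K (t - (j + 1))"
      using c(3)[OF j'(1)] j' by simp
    show "Cod (op_cat \<A>) (i (t - 1 - j)) = K (t - j)"
      using c(2)[OF j'(1)] unfolding j'(2) by simp
  next
    fix j assume j: "0 < j \<and> j < t"
    then have j': "0 < t - j" "t - j < t" "t - 1 - (j - 1) = t - j" "t - j - 1 = t - 1 - j" by auto
    have "rev E ! j = E ! (t - j)" using j len by (simp add: rev_nth)
    then show "rev E ! j = p (t - 1 - (j - 1)) \<cdot>\<^bsub>op_cat \<A>\<^esub> i (t - 1 - j)"
      using eq(3)[OF j'(1,2)] unfolding j'(3,4) by simp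
  qed (use t len K eq in \<open>auto simp: rev_nth\<close>)
qed

context extension_closed_subcategory
begin

text \<open>Dualizing reverses the direction of the morphism; the symmetric zigzags in
  \<open>ext_rel\<close> absorb this.\<close>

lemma yoneda_step_rev:
  assumes E: "E \<in> long_conflations \<A> \<C> t A B" and F: "F \<in> long_conflations \<A> \<C> t A B"
    and step: "yoneda_step \<A> t E F"
  shows "yoneda_step (op_cat \<A>) t (rev F) (rev E)"
proof -
  note d = long_conflationsD[OF E] and f = long_conflationsD[OF F]
  obtain \<phi> where \<phi>: "\<And>j. j<t \<Longrightarrow> \<phi> j \<in> homset \<A> (Dom \<A> (E ! j)) (Dom \<A> (F ! j))"
    and a: "F ! 0 \<cdot> \<phi> 0 = E ! 0" "\<phi> (t - 1) \<cdot> (E ! t) = F ! t"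
      "\<And>j. 0 < j \<Longrightarrow> j < t \<Longrightarrow> F ! j \<cdot> \<phi> j = \<phi> (j - 1) \<cdot> (E ! j)"
    using step unfolding yoneda_step_def by blast
  have rev: "rev E ! j = E ! (t - j)" "rev F ! j = F ! (t - j)" if "j \<le> t" for j
    using that d(2) f(2) by (simp_all add: rev_nth)
  show ?thesis
    unfolding yoneda_step_def
  proof (intro exI[of _ "\<lambda>j. \<phi> (t - 1 - j)"] conjI allI impI)
    fix j assume j: "j < t"
    then have j': "t - 1 - j < t" "0 < t - j" "t - j \<le> t" "t - j - 1 = t - 1 - j" by auto
    show "\<phi> (t - 1 - j) \<in> homset (op_cat \<A>) (Dom (op_cat \<A>) (rev F ! j)) (Dom (op_cat \<A>) (rev E ! j))"
      using \<phi>[OF j'(1)] d(8)[OF j'(2,3)] f(8)[OF j'(2,3)] rev[of j] j j'(4) by simp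
  next
    fix j assume j: "0 < j \<and> j < t"
    then have j': "0 < t - j" "t - j < t" "t - 1 - (j - 1) = t - j" "t - j - 1 = t - 1 - j" by auto
    show "rev E ! j \<cdot>\<^bsub>op_cat \<A>\<^esub> \<phi> (t - 1 - j) = \<phi> (t - 1 - (j - 1)) \<cdot>\<^bsub>op_cat \<A>\<^esub> (rev F ! j)"
      using a(3)[OF j'(1,2)] rev[of j] j unfolding j'(3,4) by simp
  qed (use a d(1) rev[of 0] rev[of t] in simp_all)
qed

lemma ext_rel_rev:
  assumes "(E, F) \<in> ext_rel \<A> \<C> t A B"
  shows "(rev E, rev F) \<in> ext_rel (op_cat \<A>) \<C> t B A"
  using assms
proof (induction rule: ext_rel_induct)
  case refl
  have "E \<in> long_conflations \<A> \<C> t A B" using assms by (simp add: ext_rel_def)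
  then show ?case by (intro ext_rel_refl long_conflations_rev)
next
  case (step F G)
  note FG = step.hyps
  have "(rev G, rev F) \<in> ext_rel (op_cat \<A>) \<C> t B A"
    by (rule ext_rel_step[OF FG(2,1)[THEN long_conflations_rev] yoneda_step_rev[OF FG]])
  from ext_rel_trans[OF step.IH ext_rel_sym[OF this]] show ?case .
next
  case (step_rev F G)
  note FG = step_rev.hyps
  have "(rev F, rev G) \<in> ext_rel (op_cat \<A>) \<C> t B A"
    by (rule ext_rel_step[OF FG(1,2)[THEN long_conflations_rev] yoneda_step_rev[OF FG(2,1,3)]])
  from ext_rel_trans[OF step_rev.IH this] show ?case .
qed

text \<open>Both \<open>rev\<close> and \<open>op_cat\<close> are involutions, so one direction is
  \<open>ext_rel_rev\<close> in \<open>\<A>\<close> and the other is the same lemma in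
  \<open>op_cat \<A>\<close>.\<close>

lemma ext_rel_op_cat_iff:
  "(E, F) \<in> ext_rel (op_cat \<A>) \<C> t B A \<longleftrightarrow> (rev E, rev F) \<in> ext_rel \<A> \<C> t A B"
proof -
  interpret D: extension_closed_subcategory "op_cat \<A>" \<C>
    by (rule extension_closed_subcategory_op_cat)
  show ?thesis
    using ext_rel_rev[of "rev E" "rev F" t A B] D.ext_rel_rev[of E F t B A] by auto
qed

lemma ext_class_op_cat: "ext_class (op_cat \<A>) \<C> t B A (rev E) = rev ` ext_class \<A> \<C> t A B E"
proof (rule Set.set_eqI)
  fix F
  have "F \<in> rev ` ext_class \<A> \<C> t A B E \<longleftrightarrow> rev F \<in> ext_class \<A> \<C> t A B E"
    by (metis image_iff rev_rev_ident)
  then show "F \<in> ext_class (op_cat \<A>) \<C> t B A (rev E) \<longleftrightarrow> F \<in> rev ` ext_class \<A> \<C> t A B E"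
    by (simp add: ext_class_def ext_rel_op_cat_iff)
qed

lemma pushout_sequence_op_cat:
  assumes t: "1 \<le> t" and len: "length E = t + 1"
  shows "pushout_sequence (op_cat \<A>) t h (rev E) E' \<longleftrightarrow> pullback_sequence \<A> t h E (rev E')"
proof (cases "length E' = t + 1")
  case False
  then show ?thesis by (simp add: pushout_sequence_def pullback_sequence_def)
next
  case True
  have rev: "rev E ! j = E ! (t - j)" "rev E' ! j = E' ! (t - j)" if "j \<le> t" for j
    using that len True by (simp_all add: rev_nth)
  \<comment> \<open>The reflection \<open>t - j\<close> exchanges the entries kept by a push-out, of
    index below \<open>t - 1\<close>, with those kept by a pull-back, of index above 1.\<close>
  have "(\<forall>j<t - 1. E' ! j = E ! (t - j)) \<longleftrightarrow> (\<forall>j. 1 < j \<and> j \<le> t \<longrightarrow> E' ! (t - j) = E ! j)" (is "?l \<longleftrightarrow> ?r")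
  proof
    assume l: ?l
    show ?r
    proof (intro allI impI)
      fix j assume j: "1 < j \<and> j \<le> t"
      then have "t - j < t - 1" by linarith
      with j show "E' ! (t - j) = E ! j" using l[rule_format, of "t - j"] t by simp
    qed
  next
    assume r: ?r
    show ?l
    proof (intro allI impI)
      fix j assume j: "j < t - 1"
      then have "1 < t - j" by linarith
      with j show "E' ! j = E ! (t - j)" using r[rule_format, of "t - j"] t by simp
    qed
  qed
  then show ?thesis
    using t True rev unfolding pushout_sequence_def pullback_sequence_def
    by (simp add: is_pushout_op_cat)
qed

lemma ext_push_op_cat:
  assumes "X \<subseteq> long_conflations \<A> \<C> t A B"
  shows "ext_push (op_cat \<A>) \<C> t B h (rev ` X) = rev ` ext_pull \<A> \<C> t B h X"
proof -
  have po: "pushout_sequence (op_cat \<A>) t h (rev E) E' \<longleftrightarrow> pullback_sequence \<A> t h E (rev E')"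
    if "E \<in> X" for E E'
    using that assms long_conflationsD(1,2) by (intro pushout_sequence_op_cat) blast+
  have "F \<in> ext_push (op_cat \<A>) \<C> t B h (rev ` X) \<longleftrightarrow> rev F \<in> ext_pull \<A> \<C> t B h X" for F
  proof -
    have "F \<in> ext_push (op_cat \<A>) \<C> t B h (rev ` X) \<longleftrightarrow>
        (\<exists>E'. (\<exists>E\<in>X. pullback_sequence \<A> t h E (rev E')) \<and> (rev E', rev F) \<in> ext_rel \<A> \<C> t (Dom \<A> h) B)"
      using po by (auto simp: ext_push_def ext_rel_op_cat_iff)
    also have "\<dots> \<longleftrightarrow> rev F \<in> ext_pull \<A> \<C> t B h X"
      unfolding ext_pull_def by (simp add: Image_iff) (metis rev_rev_ident)
    finally show ?thesis .
  qed
  moreover have "F \<in> rev ` Y \<longleftrightarrow> rev F \<in> Y" for F :: "'m list" and Y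
    by (metis image_iff rev_rev_ident)
  ultimately show ?thesis by blast
qed

lemma ext_class_eq_ext_pull:
  assumes enough: "\<And>X. X \<in> \<C> \<Longrightarrow> \<exists>Q i. Q \<in> \<Q> \<and> i \<in> homset \<A> X Q \<and> inflation \<A> \<C> i"
    and E: "E \<in> long_conflations \<A> \<C> t A B"
  obtains A' \<delta> f where "\<delta> \<in> long_conflations \<A> \<C> t A' B" "\<And>j. j < t \<Longrightarrow> Dom \<A> (\<delta> ! j) \<in> \<Q>"
    "f \<in> homset \<A> A A'" "ext_class \<A> \<C> t A B E = ext_pull \<A> \<C> t B f (ext_class \<A> \<C> t A' B \<delta>)"
proof -
  interpret D: extension_closed_subcategory "op_cat \<A>" \<C>
    by (rule extension_closed_subcategory_op_cat)
  have enough': "\<exists>P p. P \<in> \<Q> \<and> p \<in> homset (op_cat \<A>) P X \<and> deflation (op_cat \<A>) \<C> p" if "X \<in> \<C>" for X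
    using enough[OF that] by (simp add: deflation_def inflation_def conflation_op_cat)
  obtain A' \<epsilon> f where \<epsilon>: "\<epsilon> \<in> long_conflations (op_cat \<A>) \<C> t B A'"
    and \<Q>: "\<And>j. j < t \<Longrightarrow> Dom (op_cat \<A>) (\<epsilon> ! j) \<in> \<Q>" and f: "f \<in> homset (op_cat \<A>) A' A"
    and eq: "ext_class (op_cat \<A>) \<C> t B A (rev E) =
      ext_push (op_cat \<A>) \<C> t B f (ext_class (op_cat \<A>) \<C> t B A' \<epsilon>)"
    using D.ext_class_eq_ext_push[OF enough' long_conflations_rev[OF E]] by metis
  define \<delta> where "\<delta> = rev \<epsilon>"
  have \<delta>: "\<delta> \<in> long_conflations \<A> \<C> t A' B"
    using long_conflations_rev[OF \<epsilon>] by (simp add: \<delta>_def)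
  note d = long_conflationsD[OF \<delta>]
  show ?thesis
  proof (rule that[OF \<delta>])
    show "Dom \<A> (\<delta> ! j) \<in> \<Q>" if "j < t" for j
    proof -
      \<comment> \<open>In the opposite category the term of index \<open>j\<close> appears as the
        codomain of the map entering it, \<open>\<delta> ! Suc j\<close>; this explains the
        shift.\<close>
      have "\<epsilon> ! (t - Suc j) = \<delta> ! Suc j" using that d(2) by (simp add: \<delta>_def rev_nth)
      then show ?thesis using \<Q>[of "t - Suc j"] d(8)[of "Suc j"] that by simp
    qed
    show "f \<in> homset \<A> A A'" using f by simp
    have "ext_class \<A> \<C> t A' B \<delta> \<subseteq> long_conflations \<A> \<C> t A' B"
      by (auto simp: ext_class_def ext_rel_def)
    moreover have "rev ` ext_class \<A> \<C> t A' B \<delta> = ext_class (op_cat \<A>) \<C> t B A' \<epsilon>"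
      using ext_class_op_cat[of t B A' \<delta>] by (simp add: \<delta>_def)
    ultimately have "rev ` ext_class \<A> \<C> t A B E = rev ` ext_pull \<A> \<C> t B f (ext_class \<A> \<C> t A' B \<delta>)"
      using eq ext_push_op_cat[of "ext_class \<A> \<C> t A' B \<delta>" t A' B f] by (simp add: ext_class_op_cat)
    then show "ext_class \<A> \<C> t A B E = ext_pull \<A> \<C> t B f (ext_class \<A> \<C> t A' B \<delta>)"
      by (simp add: inj_image_eq_iff)
  qed
qed

end

text \<open>The sets of unit conflations fix only one end, so the other end is recovered from the
  sequence as \<open>Cod \<A> (\<delta> ! 0)\<close> or
  \<open>Dom \<A> (\<delta> ! k)\<close>.\<close>

theorem proposition5p2:
  fixes \<A> :: "('o, 'm) precat" and \<C> :: "'o set" and n k :: nat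
    and M N L :: 'o and \<gamma> :: "'m list set"
  assumes "n_Frobenius_category \<A> \<C> n"
    and "k \<ge> 1"
    and "M \<in> \<C>" and "N \<in> \<C>"
    and "is_syzygy \<A> \<C> n k N L"
    and "\<gamma> \<in> Ext \<A> \<C> k M L"
  shows "(\<exists>\<delta> \<in> units_beginning_with \<A> \<C> n k L. \<exists>f \<in> homset \<A> M (Cod \<A> (\<delta> ! 0)).
            \<gamma> = ext_pull \<A> \<C> k L f (ext_class \<A> \<C> k (Cod \<A> (\<delta> ! 0)) L \<delta>)) \<and>
         (\<exists>\<delta> \<in> units_ending_at \<A> \<C> n k M. \<exists>g \<in> homset \<A> (Dom \<A> (\<delta> ! k)) L.
            \<gamma> = ext_push \<A> \<C> k M g (ext_class \<A> \<C> k M (Dom \<A> (\<delta> ! k)) \<delta>))"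
proof
  interpret n_Frobenius_category \<A> \<C> n by (rule assms(1))
  obtain E where E: "E \<in> long_conflations \<A> \<C> k M L" and \<gamma>: "\<gamma> = ext_class \<A> \<C> k M L E"
    using assms(6) by (auto simp: Ext_def ext_class_def elim: quotientE)
  let ?\<P> = "{P. n_projective \<A> \<C> n P}"
  have proj: "\<exists>P p. P \<in> ?\<P> \<and> p \<in> homset \<A> P X \<and> deflation \<A> \<C> p" if "X \<in> \<C>" for X
    using enough_projectives[OF that] by simp
  have inj: "\<exists>Q i. Q \<in> ?\<P> \<and> i \<in> homset \<A> X Q \<and> inflation \<A> \<C> i" if "X \<in> \<C>" for X
    using enough_injectives[OF that] by (simp add: projective_iff_injective)
  obtain A' \<delta> f where \<delta>: "\<delta> \<in> long_conflations \<A> \<C> k A' L" "\<And>j. j < k \<Longrightarrow> Dom \<A> (\<delta> ! j) \<in> ?\<P>"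
    and f: "f \<in> homset \<A> M A'" "ext_class \<A> \<C> k M L E = ext_pull \<A> \<C> k L f (ext_class \<A> \<C> k A' L \<delta>)"
    using ext_class_eq_ext_pull[OF inj E] by metis
  have "\<delta> \<in> units_beginning_with \<A> \<C> n k L"
    using \<delta> long_conflationsD(3)[OF \<delta>(1)] by (auto simp: units_beginning_with_def unit_conflations_def)
  then show "\<exists>\<delta> \<in> units_beginning_with \<A> \<C> n k L. \<exists>f \<in> homset \<A> M (Cod \<A> (\<delta> ! 0)).
      \<gamma> = ext_pull \<A> \<C> k L f (ext_class \<A> \<C> k (Cod \<A> (\<delta> ! 0)) L \<delta>)"
    using f long_conflationsD(6)[OF \<delta>(1)] \<gamma> by auto
  obtain B' \<epsilon> g where \<epsilon>: "\<epsilon> \<in> long_conflations \<A> \<C> k M B'" "\<And>j. j < k \<Longrightarrow> Dom \<A> (\<epsilon> ! j) \<in> ?\<P>"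
    and g: "g \<in> homset \<A> B' L" "ext_class \<A> \<C> k M L E = ext_push \<A> \<C> k M g (ext_class \<A> \<C> k M B' \<epsilon>)"
    using ext_class_eq_ext_push[OF proj E] by metis
  have "\<epsilon> \<in> units_ending_at \<A> \<C> n k M"
    using \<epsilon> long_conflationsD(4)[OF \<epsilon>(1)] by (auto simp: units_ending_at_def unit_conflations_def)
  then show "\<exists>\<delta> \<in> units_ending_at \<A> \<C> n k M. \<exists>g \<in> homset \<A> (Dom \<A> (\<delta> ! k)) L.
      \<gamma> = ext_push \<A> \<C> k M g (ext_class \<A> \<C> k M (Dom \<A> (\<delta> ! k)) \<delta>)"
    using g long_conflationsD(7)[OF \<epsilon>(1)] \<gamma> by auto
qed

end
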